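(* Let $\mathcal{A}$ be either an involutive Hopf algebra, or a coquasi-triangular $*$-bialgebra whose universal R-form $r$ satisfies $r=\overline{\phantom{a}}\circ\bar r\circ( *\otimes* )$, let $\mathcal{B}$ be a braided $*$-bialgebra in the associated braided category $(\mathcal{C}_*(\mathcal{A}),\Psi)$ with coaction $\gamma:\mathcal{B}\to\mathcal{A}\otimes\mathcal{B}$, and let $H=\mathcal{B}\otimes\mathcal{A}$ be its symmetrization. Let $(j_{st})_{0\le s\le t\le T}$ be a Lévy process on $\mathcal{B}$ with convolution semigroup $(\varphi_t)_{t\ge0}$, and let $(j^H_{st})_{0\le s\le t\le T}$ be a Lévy process on $H$ with convolution semigroup $(F\varphi_t)_{t\ge0}$, where $F\varphi=\varphi\otimes\varepsilon_{\mathcal A}$. Then $(\hat\jmath_{st})_{0\le s\le t\le T}$ with $$\hat\jmath_{st}=m\circ(j^H_{0s}\otimes j^H_{st})\circ(1_{\mathcal B}\otimes\gamma\otimes1_{\mathcal A}),\quad\text{i.e.}\quad\hat\jmath_{st}(b)=\sum j^H_{0s}(1_{\mathcal B}\otimes b_{(-1)})\,j^H_{st}(b_{(0)}\otimes1_{\mathcal A}),$$ ($m$ denoting multiplication in the target algebra) defines a Lévy process on $\mathcal{B}$. Furthermore, $(\hat\jmath_{st})_{0\le s\le t\le T}$ is equivalent to $(j_{st})_{0\le s\le t\le T}$.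
   Context: All spaces are complex; $\tau$ denotes flips. Sweedler notation: $\Delta(a)=a_{(1)}\otimes a_{(2)}$; $\gamma(v)=v_{(-1)}\otimes v_{(0)}$ for left coactions; $a\cdot v$ for left actions. Category, Hopf case: $\mathcal{A}$ is a Hopf $*$-algebra with antipode $S$; objects are complex vector spaces $V$ with left action, left coaction and anti-linear involution such that $a_{(1)}v_{(-1)}\otimes a_{(2)}\cdot v_{(0)}=(a_{(1)}\cdot v)_{(-1)}a_{(2)}\otimes(a_{(1)}\cdot v)_{(0)}$, $(a\cdot v)^*=S(a)^*\cdot v^*$, $\gamma(v^* )=(v_{(-1)})^*\otimes(v_{(0)})^*$. Coquasi-triangular case: $\mathcal{A}$ is a $*$-bialgebra with a convolution-invertible functional $r:\mathcal{A}\otimes\mathcal{A}\to\mathbb{C}$ (inverse $\bar r$) with $m^{\rm op}=r\star m\star\bar r$, $r\circ(m\otimes\mathrm{id})=r_{13}\star r_{23}$, $r\circ(\mathrm{id}\otimes m)=r_{13}\star r_{12}$, $r(a\otimes b)=\overline{\bar r(a^*\otimes b^* )}$; objects are complex vector spaces with left coaction and anti-linear involution with $\gamma(v^* )=(v_{(-1)})^*\otimes(v_{(0)})^*$, and the action used is $a\cdot v=\bar r(a\otimes v_{(-1)})v_{(0)}$. Morphisms are module and comodule maps; tensor products carry the diagonal action and codiagonal coaction; the braiding is $\Psi(v\otimes w)=v_{(-1)}\cdot w\otimes v_{(0)}$. A braided $*$-bialgebra $\mathcal{B}$ in this category is an object with morphisms $m_{\mathcal B},1_{\mathcal B},\Delta_{\mathcal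 B},\varepsilon_{\mathcal B}$ making it an algebra and a coalgebra, with $\varepsilon_{\mathcal B}$ a homomorphism and $\Delta_{\mathcal B}$ a homomorphism for the product $(m_{\mathcal B}\otimes m_{\mathcal B})\circ(\mathrm{id}\otimes\Psi\otimes\mathrm{id})$ on $\mathcal{B}\otimes\mathcal{B}$, such that $\mathcal{B}$ is a $*$-algebra and $\Delta_{\mathcal B}$ is a $*$-homomorphism for the involution $\Psi\circ( *\otimes* )\circ\tau$. Symmetrization: $H=\mathcal{B}\otimes\mathcal{A}$ is the (ordinary) $*$-bialgebra with $(b\otimes a)(d\otimes c)=b(a_{(1)}\cdot d)\otimes a_{(2)}c$, $\Delta_H(b\otimes a)=b_{(1)}\otimes(b_{(2)})_{(-1)}a_{(1)}\otimes(b_{(2)})_{(0)}\otimes a_{(2)}$, $\varepsilon_H=\varepsilon_{\mathcal B}\otimes\varepsilon_{\mathcal A}$, $(b\otimes a)^*=(a_{(1)})^*\cdot b^*\otimes(a_{(2)})^*$. Lévy processes: let $\mathcal{D}$ be a braided $*$-bialgebra with braiding $\Psi$ (for the ordinary $*$-bialgebra $H$ take $\Psi=\tau$). A Lévy process on $\mathcal{D}$ is a family of unital $*$-homomorphisms $j_{st}:\mathcal{D}\to\mathcal{E}$, $0\le s\le t\le T$, into a $*$-algebra $\mathcal{E}$ with state $\Phi$, such that: (1) $j_{rs}\star j_{st}=j_{rt}$, $j_{tt}=\varepsilon\mathbf{1}$, where $f\star g=m\circ(f\otimes g)\circ\Delta$; (2) for $0\le s_1\le t_1\le s_2\le\cdots\le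 t_n\le T$ the tuple $(j_1,\ldots,j_n)=(j_{s_1t_1},\ldots,j_{s_nt_n})$ is $\Psi$-independent: $\Phi(j_{\sigma(1)}(b_1)\cdots j_{\sigma(n)}(b_n))=\prod_k\Phi(j_{\sigma(k)}(b_k))$ for all permutations $\sigma$ and all $b_k$, and $m\circ(j_l\otimes j_k)=m\circ(j_k\otimes j_l)\circ\Psi$ for $k<l$; (3) $\Phi\circ j_{st}=:\varphi_{t-s}$ depends only on $t-s$; (4) $\Phi\circ j_{st}\to\varepsilon$ pointwise for $t\searrow s$. $(\varphi_t)$ is its convolution semigroup of (marginal) states. Two processes are equivalent if all joint moments $\Phi(j_{s_1t_1}(b_1)\cdots j_{s_nt_n}(b_n))$ coincide. *)

theory Defs
  imports Complex_Main "HOL-Library.Poly_Mapping" "HOL-Combinatorics.Permutations"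
begin

section \<open>Complex vector spaces and complex unital \<open>*\<close>-algebras\<close>

class complex_vector = ab_group_add +
  fixes scaleC :: "complex \<Rightarrow> 'a \<Rightarrow> 'a"  (infixr "*\<^sub>C" 75)
  assumes scaleC_add_right: "a *\<^sub>C (x + y) = a *\<^sub>C x + a *\<^sub>C y"
    and scaleC_add_left: "(a + b) *\<^sub>C x = a *\<^sub>C x + b *\<^sub>C x"
    and scaleC_scaleC: "a *\<^sub>C b *\<^sub>C x = (a * b) *\<^sub>C x"
    and scaleC_one: "1 *\<^sub>C x = x"

global_interpretation complex_vector:
  vector_space "scaleC :: complex \<Rightarrow> 'a \<Rightarrow> 'a::complex_vector"
  by unfold_locales (simp_all add: scaleC_add_right scaleC_add_left scaleC_scaleC scaleC_one)

class star_vector = complex_vector +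
  fixes star :: "'a \<Rightarrow> 'a"
  assumes star_add: "star (x + y) = star x + star y"
    and star_scaleC: "star (c *\<^sub>C x) = cnj c *\<^sub>C star x"
    and star_star: "star (star x) = x"

text \<open>The class \<^class>\<open>ring_1\<close> includes \<open>0 \<noteq> 1\<close>.  This is no restriction below: every algebra that
  occurs carries a unital linear functional with values in \<open>\<complex>\<close> (a counit or a state).\<close>

class star_algebra = star_vector + ring_1 +
  assumes scaleC_mult_left: "(c *\<^sub>C x) * y = c *\<^sub>C (x * y)"
    and scaleC_mult_right: "x * (c *\<^sub>C y) = c *\<^sub>C (x * y)"
    and star_mult: "star (x * y) = star y * star x"

instantiation complex :: star_algebra
begin

definition scaleC_complex :: "complex \<Rightarrow> complex \<Rightarrow> complex"
  where "scaleC_complex c x = c * x"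

definition star_complex :: "complex \<Rightarrow> complex"
  where "star_complex = cnj"

instance
  by standard (simp_all add: scaleC_complex_def star_complex_def algebra_simps)

end

abbreviation clinear :: "('v::complex_vector \<Rightarrow> 'w::complex_vector) \<Rightarrow> bool"
  where "clinear \<equiv> Vector_Spaces.linear scaleC scaleC"

definition antilinear :: "('v::complex_vector \<Rightarrow> 'w::complex_vector) \<Rightarrow> bool"
  where "antilinear f \<longleftrightarrow>
    (\<forall>x y. f (x + y) = f x + f y) \<and> (\<forall>c x. f (c *\<^sub>C x) = cnj c *\<^sub>C f x)"

definition cbilinear :: "('v::complex_vector \<Rightarrow> 'w::complex_vector \<Rightarrow> 'u::complex_vector) \<Rightarrow> bool"
  where "cbilinear f \<longleftrightarrow> (\<forall>w. clinear (\<lambda>v. f v w)) \<and> (\<forall>v. clinear (\<lambda>w. f v w))"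

definition biantilinear :: "('v::complex_vector \<Rightarrow> 'w::complex_vector \<Rightarrow> 'u::complex_vector) \<Rightarrow> bool"
  where "biantilinear f \<longleftrightarrow> (\<forall>w. antilinear (\<lambda>v. f v w)) \<and> (\<forall>v. antilinear (\<lambda>w. f v w))"

lemma clinear_iff:
  "clinear f \<longleftrightarrow> (\<forall>x y. f (x + y) = f x + f y) \<and> (\<forall>c x. f (c *\<^sub>C x) = c *\<^sub>C f x)"
  by (auto simp: Vector_Spaces.linear_iff complex_vector.vector_space_axioms)

section \<open>The algebraic tensor product\<close>

text \<open>Quotient of the free vector space on \<open>'v \<times> 'w\<close> by the span of the bilinearity relations.\<close>

instantiation poly_mapping :: (type, complex_vector) complex_vector
begin

lift_definition scaleC_poly_mapping :: "complex \<Rightarrow> ('a \<Rightarrow>\<^sub>0 'b) \<Rightarrow> ('a \<Rightarrow>\<^sub>0 'b)"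
  is "\<lambda>c f k. c *\<^sub>C f k"
  by (erule finite_subset[rotated]) auto

instance
  by standard (transfer; auto simp: scaleC_add_right scaleC_add_left scaleC_scaleC scaleC_one)+

end

definition tensor_relations :: "(('v::complex_vector \<times> 'w::complex_vector) \<Rightarrow>\<^sub>0 complex) set"
  where "tensor_relations =
    {Poly_Mapping.single (v + v', w) 1 - Poly_Mapping.single (v, w) 1 - Poly_Mapping.single (v', w) 1
       | v v' w. True} \<union>
    {Poly_Mapping.single (v, w + w') 1 - Poly_Mapping.single (v, w) 1 - Poly_Mapping.single (v, w') 1
       | v w w'. True} \<union>
    {Poly_Mapping.single (c *\<^sub>C v, w) 1 - Poly_Mapping.single (v, w) c | c v w. True} \<union>
    {Poly_Mapping.single (v, c *\<^sub>C w) 1 - Poly_Mapping.single (v, w) c | c v w. True}"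

definition tensor_eq ::
  "(('v::complex_vector \<times> 'w::complex_vector) \<Rightarrow>\<^sub>0 complex) \<Rightarrow> ('v \<times> 'w \<Rightarrow>\<^sub>0 complex) \<Rightarrow> bool"
  where "tensor_eq p q \<longleftrightarrow> p - q \<in> complex_vector.span tensor_relations"

lemma tensor_eqI: "p - q \<in> tensor_relations \<Longrightarrow> tensor_eq p q"
  by (simp add: tensor_eq_def complex_vector.span_base)

lemma equivp_tensor_eq: "equivp tensor_eq"
proof (rule equivpI)
  show "reflp tensor_eq"
    by (auto simp: reflp_def tensor_eq_def complex_vector.span_zero)
  show "symp tensor_eq"
    unfolding symp_def tensor_eq_def using complex_vector.span_neg by fastforce
  show "transp tensor_eq"
    unfolding transp_def tensor_eq_def using complex_vector.span_add by fastforce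
qed

quotient_type (overloaded) ('v, 'w) tensor (infixr "\<otimes>" 75) =
  "(('v::complex_vector \<times> 'w::complex_vector) \<Rightarrow>\<^sub>0 complex)" / tensor_eq
  by (rule equivp_tensor_eq)

instantiation tensor :: (complex_vector, complex_vector) complex_vector
begin

lift_definition zero_tensor :: "('a, 'b) tensor" is 0 .

lift_definition plus_tensor :: "('a, 'b) tensor \<Rightarrow> ('a, 'b) tensor \<Rightarrow> ('a, 'b) tensor" is "(+)"
  unfolding tensor_eq_def using complex_vector.span_add by (fastforce simp: algebra_simps)

lift_definition minus_tensor :: "('a, 'b) tensor \<Rightarrow> ('a, 'b) tensor \<Rightarrow> ('a, 'b) tensor" is "(-)"
  unfolding tensor_eq_def using complex_vector.span_diff by (fastforce simp: algebra_simps)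

lift_definition uminus_tensor :: "('a, 'b) tensor \<Rightarrow> ('a, 'b) tensor" is uminus
  unfolding tensor_eq_def using complex_vector.span_neg by (fastforce simp: algebra_simps)

lift_definition scaleC_tensor :: "complex \<Rightarrow> ('a, 'b) tensor \<Rightarrow> ('a, 'b) tensor" is scaleC
  unfolding tensor_eq_def
  by (metis complex_vector.scale_right_diff_distrib complex_vector.span_scale)

instance
  by standard
    (transfer; simp add: algebra_simps scaleC_add_right scaleC_add_left scaleC_scaleC scaleC_one
       tensor_eq_def complex_vector.span_zero)+

end

lift_definition tensor_of :: "'v::complex_vector \<Rightarrow> 'w::complex_vector \<Rightarrow> 'v \<otimes> 'w"  (infixr "\<otimes>" 75)
  is "\<lambda>v w. Poly_Mapping.single (v, w) 1" .

lemma tensor_add_left: "(v + v') \<otimes> w = v \<otimes> w + v' \<otimes> w"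
  by transfer (rule tensor_eqI, unfold tensor_relations_def diff_diff_eq[symmetric], blast)

lemma tensor_add_right: "v \<otimes> (w + w') = v \<otimes> w + v \<otimes> w'"
  by transfer (rule tensor_eqI, unfold tensor_relations_def diff_diff_eq[symmetric], blast)

lemma scaleC_single: "c *\<^sub>C Poly_Mapping.single k x = Poly_Mapping.single k (c *\<^sub>C x)"
  by transfer (auto simp: when_def)

lemma tensor_scaleC_left: "(c *\<^sub>C v) \<otimes> w = c *\<^sub>C (v \<otimes> w)"
  by transfer (rule tensor_eqI, unfold tensor_relations_def scaleC_single scaleC_complex_def mult_1_right, blast)

lemma tensor_scaleC_right: "v \<otimes> (c *\<^sub>C w) = c *\<^sub>C (v \<otimes> w)"
  by transfer (rule tensor_eqI, unfold tensor_relations_def scaleC_single scaleC_complex_def mult_1_right, blast)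

lemma poly_mapping_single_induct:
  assumes "P 0" and "\<And>f k c. P f \<Longrightarrow> P (f + Poly_Mapping.single k c)"
  shows "P (f :: 'k \<Rightarrow>\<^sub>0 'c::comm_monoid_add)"
proof (induction f rule: update_induct)
  case (update f a b)
  have "Poly_Mapping.update a b f = f + Poly_Mapping.single a b"
    using update(1)
    by (intro poly_mapping_eqI)
      (auto simp: lookup_update lookup_add lookup_single when_def in_keys_iff)
  then show ?case using assms(2)[OF update(3)] by simp
qed (use assms in \<open>simp add: zero_poly_mapping_def[symmetric]\<close>)

lemma tensor_induct [case_names zero add]:
  assumes "P 0" and "\<And>x v w. P x \<Longrightarrow> P (x + v \<otimes> w)"
  shows "P (x :: 'v::complex_vector \<otimes> 'w::complex_vector)"
proof -
  have "P (abs_tensor p)" for p :: "('v \<times> 'w) \<Rightarrow>\<^sub>0 complex"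
  proof (induction p rule: poly_mapping_single_induct)
    case 1
    then show ?case using assms(1) by (simp add: zero_tensor_def)
  next
    case (2 p k c)
    obtain v w where k: "k = (v, w)" by (cases k)
    have "abs_tensor (p + Poly_Mapping.single k c) = abs_tensor p + c *\<^sub>C (v \<otimes> w)"
      by (simp add: k plus_tensor.abs_eq scaleC_tensor.abs_eq tensor_of.abs_eq scaleC_single
          scaleC_complex_def)
    then show ?case using assms(2)[OF 2, of "c *\<^sub>C v" w] by (simp add: tensor_scaleC_left)
  qed
  then show ?thesis by (metis Quotient_abs_rep[OF Quotient_tensor])
qed

text \<open>The universal property, for linear and for antilinear maps.\<close>

definition tlift ::
  "('v::complex_vector \<Rightarrow> 'w::complex_vector \<Rightarrow> 'u::complex_vector) \<Rightarrow> 'v \<otimes> 'w \<Rightarrow> 'u"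
  where "tlift f = (THE h. clinear h \<and> (\<forall>v w. h (v \<otimes> w) = f v w))"

definition tlift_anti ::
  "('v::complex_vector \<Rightarrow> 'w::complex_vector \<Rightarrow> 'u::complex_vector) \<Rightarrow> 'v \<otimes> 'w \<Rightarrow> 'u"
  where "tlift_anti f = (THE h. antilinear h \<and> (\<forall>v w. h (v \<otimes> w) = f v w))"

lemma semilinear_extension:
  fixes \<sigma> :: "complex \<Rightarrow> complex"
    and f :: "'v::complex_vector \<Rightarrow> 'w::complex_vector \<Rightarrow> 'u::complex_vector"
  assumes \<sigma>: "\<sigma> 0 = 0" "\<sigma> 1 = 1" "\<And>c d. \<sigma> (c + d) = \<sigma> c + \<sigma> d" "\<And>c d. \<sigma> (c * d) = \<sigma> c * \<sigma> d"
    and f: "\<And>v v' w. f (v + v') w = f v w + f v' w" "\<And>v w w'. f v (w + w') = f v w + f v w'"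
      "\<And>c v w. f (c *\<^sub>C v) w = \<sigma> c *\<^sub>C f v w" "\<And>c v w. f v (c *\<^sub>C w) = \<sigma> c *\<^sub>C f v w"
  shows "\<exists>h. (\<forall>x y. h (x + y) = h x + h y) \<and> (\<forall>c x. h (c *\<^sub>C x) = \<sigma> c *\<^sub>C h x) \<and>
    (\<forall>v w. h (v \<otimes> w) = f v w)"
proof -
  define g where "g p = (\<Sum>k\<in>Poly_Mapping.keys p. \<sigma> (Poly_Mapping.lookup p k) *\<^sub>C f (fst k) (snd k))"
    for p :: "('v \<times> 'w) \<Rightarrow>\<^sub>0 complex"
  have g_add: "g (p + q) = g p + g q" for p q
    unfolding g_def
    by (rule setsum_keys_plus_distrib) (simp_all add: \<sigma> scaleC_add_left)
  have g_single: "g (Poly_Mapping.single (v, w) c) = \<sigma> c *\<^sub>C f v w" for v w c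
    by (cases "c = 0") (simp_all add: g_def \<sigma>)
  have g_scale: "g (c *\<^sub>C p) = \<sigma> c *\<^sub>C g p" for c p
  proof (induction p rule: poly_mapping_single_induct)
    case 1
    then show ?case by (simp add: g_def)
  next
    case (2 p k d)
    then show ?case
      by (cases k) (simp add: g_add g_single scaleC_add_right scaleC_single scaleC_complex_def
          \<sigma> scaleC_scaleC)
  qed
  have g_diff: "g (p - q) = g p - g q" for p q
    using g_add[of "p - q" q] by (simp add: algebra_simps)
  have f0: "f 0 w = 0" "f v 0 = 0" for v w
    using f(1)[of 0 0 w] f(2)[of v 0 0] by simp_all
  have g_span: "g p = 0" if "p \<in> complex_vector.span tensor_relations" for p
    using that
  proof (induction rule: complex_vector.span_induct_alt)
    case base
    then show ?case by (simp add: g_def)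
  next
    case (step c x y)
    have "g x = 0"
      using step(1) by (auto simp: tensor_relations_def g_diff g_single \<sigma> f scaleC_one)
    then show ?case by (simp add: g_add g_scale step)
  qed
  define h where "h x = g (rep_tensor x)" for x
  have h_abs: "h (abs_tensor p) = g p" for p
  proof -
    have "tensor_eq (rep_tensor (abs_tensor p)) p"
      using rep_abs_rsp[OF Quotient3_tensor, of p p] equivp_tensor_eq
      by (metis equivp_reflp equivp_symp)
    then show ?thesis using g_span g_diff by (fastforce simp: tensor_eq_def h_def)
  qed
  have "\<forall>x y. h (x + y) = h x + h y"
  proof (intro allI)
    fix x y
    show "h (x + y) = h x + h y"
      by (induction x, induction y) (simp add: plus_tensor.abs_eq h_abs g_add)
  qed
  moreover have "\<forall>c x. h (c *\<^sub>C x) = \<sigma> c *\<^sub>C h x"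
  proof (intro allI)
    fix c x
    show "h (c *\<^sub>C x) = \<sigma> c *\<^sub>C h x"
      by (induction x) (simp add: scaleC_tensor.abs_eq h_abs g_scale)
  qed
  moreover have "\<forall>v w. h (v \<otimes> w) = f v w"
    by (simp add: tensor_of.abs_eq h_abs g_single \<sigma> scaleC_one)
  ultimately show ?thesis by blast
qed

lemma tensor_map_unique:
  fixes h h' :: "'v::complex_vector \<otimes> 'w::complex_vector \<Rightarrow> 'u::complex_vector"
  assumes "\<And>x y. h (x + y) = h x + h y" "\<And>x y. h' (x + y) = h' x + h' y"
    and "\<And>v w. h (v \<otimes> w) = h' (v \<otimes> w)"
  shows "h = h'"
proof
  fix x
  show "h x = h' x"
  proof (induction x rule: tensor_induct)
    case zero
    then show ?case using assms(1)[of 0 0] assms(2)[of 0 0] by simp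
  qed (simp add: assms)
qed

lemma tlift:
  assumes "cbilinear f"
  shows clinear_tlift: "clinear (tlift f)" and tlift_tensor: "tlift f (v \<otimes> w) = f v w"
proof -
  have "\<exists>h. clinear h \<and> (\<forall>v w. h (v \<otimes> w) = f v w)"
    using semilinear_extension[of "\<lambda>c. c" f] assms by (simp add: cbilinear_def clinear_iff)
  moreover have "h = h'" if "clinear h \<and> (\<forall>v w. h (v \<otimes> w) = f v w)"
    and "clinear h' \<and> (\<forall>v w. h' (v \<otimes> w) = f v w)" for h h'
    using that by (intro tensor_map_unique) (simp_all add: clinear_iff)
  ultimately have "\<exists>!h. clinear h \<and> (\<forall>v w. h (v \<otimes> w) = f v w)" by blast
  from theI'[OF this] show "clinear (tlift f)" "tlift f (v \<otimes> w) = f v w"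
    by (auto simp: tlift_def)
qed

lemma tlift_anti:
  assumes "biantilinear f"
  shows antilinear_tlift_anti: "antilinear (tlift_anti f)"
    and tlift_anti_tensor: "tlift_anti f (v \<otimes> w) = f v w"
proof -
  have "\<exists>h. antilinear h \<and> (\<forall>v w. h (v \<otimes> w) = f v w)"
    using semilinear_extension[of cnj f] assms by (simp add: biantilinear_def antilinear_def)
  moreover have "h = h'" if "antilinear h \<and> (\<forall>v w. h (v \<otimes> w) = f v w)"
    and "antilinear h' \<and> (\<forall>v w. h' (v \<otimes> w) = f v w)" for h h'
    using that by (intro tensor_map_unique) (simp_all add: antilinear_def)
  ultimately have "\<exists>!h. antilinear h \<and> (\<forall>v w. h (v \<otimes> w) = f v w)" by blast
  from theI'[OF this] show "antilinear (tlift_anti f)" "tlift_anti f (v \<otimes> w) = f v w"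
    by (auto simp: tlift_anti_def)
qed

text \<open>In what follows, an expression \<open>tlift (\<lambda>a b. t a b) (\<Delta> x)\<close> is the Sweedler sum \<open>t x\<^sub>(\<^sub>1\<^sub>) x\<^sub>(\<^sub>2\<^sub>)\<close>.\<close>

definition tmap ::
  "('v::complex_vector \<Rightarrow> 'x::complex_vector) \<Rightarrow> ('w::complex_vector \<Rightarrow> 'y::complex_vector)
    \<Rightarrow> 'v \<otimes> 'w \<Rightarrow> 'x \<otimes> 'y"
  where "tmap f g = tlift (\<lambda>v w. f v \<otimes> g w)"

definition flip :: "'v::complex_vector \<otimes> 'w::complex_vector \<Rightarrow> 'w \<otimes> 'v"
  where "flip = tlift (\<lambda>v w. w \<otimes> v)"

definition assoc ::
  "('u::complex_vector \<otimes> 'v::complex_vector) \<otimes> 'w::complex_vector \<Rightarrow> 'u \<otimes> 'v \<otimes> 'w"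
  where "assoc = tlift (\<lambda>x w. tlift (\<lambda>u v. u \<otimes> v \<otimes> w) x)"

definition star_tensor :: "'v::star_vector \<otimes> 'w::star_vector \<Rightarrow> 'v \<otimes> 'w"
  where "star_tensor = tlift_anti (\<lambda>v w. star v \<otimes> star w)"


section \<open>Coalgebras, convolution and (braided) \<open>*\<close>-bialgebras\<close>

definition coalgebra :: "('c::complex_vector \<Rightarrow> 'c \<otimes> 'c) \<Rightarrow> ('c \<Rightarrow> complex) \<Rightarrow> bool"
  where "coalgebra \<Delta> \<epsilon> \<longleftrightarrow> clinear \<Delta> \<and> clinear \<epsilon> \<and>
    (\<forall>x. assoc (tmap \<Delta> id (\<Delta> x)) = tmap id \<Delta> (\<Delta> x)) \<and>
    (\<forall>x. tlift (\<lambda>a b. \<epsilon> a *\<^sub>C b) (\<Delta> x) = x) \<and>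
    (\<forall>x. tlift (\<lambda>a b. \<epsilon> b *\<^sub>C a) (\<Delta> x) = x)"

text \<open>The comultiplication \<open>(id \<otimes> flip \<otimes> id) \<circ> (\<Delta> \<otimes> \<Delta>')\<close> of the tensor product of two coalgebras.\<close>

definition tensor_comult ::
  "('c::complex_vector \<Rightarrow> 'c \<otimes> 'c) \<Rightarrow> ('d::complex_vector \<Rightarrow> 'd \<otimes> 'd)
    \<Rightarrow> 'c \<otimes> 'd \<Rightarrow> ('c \<otimes> 'd) \<otimes> ('c \<otimes> 'd)"
  where "tensor_comult \<Delta> \<Delta>' = tlift (\<lambda>c d.
    tlift (\<lambda>c1 c2. tlift (\<lambda>d1 d2. (c1 \<otimes> d1) \<otimes> (c2 \<otimes> d2)) (\<Delta>' d)) (\<Delta> c))"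

text \<open>Convolution with respect to a bilinear pairing \<open>\<beta>\<close> of the targets: the multiplication of an
  algebra, or scalar multiplication if one of the factors is a functional.\<close>

definition convolve ::
  "('c::complex_vector \<Rightarrow> 'c \<otimes> 'c) \<Rightarrow> ('x \<Rightarrow> 'y \<Rightarrow> 'z::complex_vector)
    \<Rightarrow> ('c \<Rightarrow> 'x) \<Rightarrow> ('c \<Rightarrow> 'y) \<Rightarrow> 'c \<Rightarrow> 'z"
  where "convolve \<Delta> \<beta> f g x = tlift (\<lambda>a b. \<beta> (f a) (g b)) (\<Delta> x)"

text \<open>The product \<open>(m \<otimes> m) \<circ> (id \<otimes> \<Psi> \<otimes> id)\<close> and the involution \<open>\<Psi> \<circ> (* \<otimes> *) \<circ> flip\<close>.\<close>

definition braided_mult ::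
  "('b::star_algebra \<otimes> 'b \<Rightarrow> 'b \<otimes> 'b) \<Rightarrow> 'b \<otimes> 'b \<Rightarrow> 'b \<otimes> 'b \<Rightarrow> 'b \<otimes> 'b"
  where "braided_mult \<Psi> x y =
    tlift (\<lambda>a b. tlift (\<lambda>c d. tlift (\<lambda>c' b'. (a * c') \<otimes> (b' * d)) (\<Psi> (b \<otimes> c))) y) x"

definition braided_star :: "('b::star_algebra \<otimes> 'b \<Rightarrow> 'b \<otimes> 'b) \<Rightarrow> 'b \<otimes> 'b \<Rightarrow> 'b \<otimes> 'b"
  where "braided_star \<Psi> x = \<Psi> (star_tensor (flip x))"

definition star_bialgebra_wrt ::
  "('b::star_algebra \<otimes> 'b \<Rightarrow> 'b \<otimes> 'b) \<Rightarrow> ('b \<Rightarrow> 'b \<otimes> 'b) \<Rightarrow> ('b \<Rightarrow> complex) \<Rightarrow> bool"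
  where "star_bialgebra_wrt \<Psi> \<Delta> \<epsilon> \<longleftrightarrow> coalgebra \<Delta> \<epsilon> \<and>
    \<epsilon> 1 = 1 \<and> (\<forall>x y. \<epsilon> (x * y) = \<epsilon> x * \<epsilon> y) \<and>
    \<Delta> 1 = 1 \<otimes> 1 \<and> (\<forall>x y. \<Delta> (x * y) = braided_mult \<Psi> (\<Delta> x) (\<Delta> y)) \<and>
    (\<forall>x. \<Delta> (star x) = braided_star \<Psi> (\<Delta> x))"

text \<open>For \<open>\<Psi> = flip\<close> the involution \<^term>\<open>braided_star flip\<close> is the usual \<open>* \<otimes> *\<close>.\<close>

definition star_bialgebra :: "('a::star_algebra \<Rightarrow> 'a \<otimes> 'a) \<Rightarrow> ('a \<Rightarrow> complex) \<Rightarrow> bool"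
  where "star_bialgebra \<Delta> \<epsilon> \<longleftrightarrow> star_bialgebra_wrt flip \<Delta> \<epsilon> \<and> (\<forall>x. \<epsilon> (star x) = cnj (\<epsilon> x))"

definition hopf_star_algebra ::
  "('a::star_algebra \<Rightarrow> 'a \<otimes> 'a) \<Rightarrow> ('a \<Rightarrow> complex) \<Rightarrow> ('a \<Rightarrow> 'a) \<Rightarrow> bool"
  where "hopf_star_algebra \<Delta> \<epsilon> S \<longleftrightarrow> star_bialgebra \<Delta> \<epsilon> \<and> clinear S \<and>
    convolve \<Delta> (*) S id = (\<lambda>a. \<epsilon> a *\<^sub>C 1) \<and> convolve \<Delta> (*) id S = (\<lambda>a. \<epsilon> a *\<^sub>C 1)"

text \<open>\<open>r\<^sub>1\<^sub>2\<close>, \<open>r\<^sub>1\<^sub>3\<close>, \<open>r\<^sub>2\<^sub>3\<close>: a functional on two of three legs, the counit on the remaining one.\<close>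

definition leg12 :: "('a::complex_vector \<Rightarrow> complex) \<Rightarrow> ('a \<otimes> 'a \<Rightarrow> complex) \<Rightarrow> 'a \<otimes> 'a \<otimes> 'a \<Rightarrow> complex"
  where "leg12 \<epsilon> r = tlift (\<lambda>a y. tlift (\<lambda>b c. r (a \<otimes> b) * \<epsilon> c) y)"

definition leg13 :: "('a::complex_vector \<Rightarrow> complex) \<Rightarrow> ('a \<otimes> 'a \<Rightarrow> complex) \<Rightarrow> 'a \<otimes> 'a \<otimes> 'a \<Rightarrow> complex"
  where "leg13 \<epsilon> r = tlift (\<lambda>a y. tlift (\<lambda>b c. r (a \<otimes> c) * \<epsilon> b) y)"

definition leg23 :: "('a::complex_vector \<Rightarrow> complex) \<Rightarrow> ('a \<otimes> 'a \<Rightarrow> complex) \<Rightarrow> 'a \<otimes> 'a \<otimes> 'a \<Rightarrow> complex"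
  where "leg23 \<epsilon> r = tlift (\<lambda>a y. tlift (\<lambda>b c. \<epsilon> a * r (b \<otimes> c)) y)"

definition coquasitriangular_star_bialgebra ::
  "('a::star_algebra \<Rightarrow> 'a \<otimes> 'a) \<Rightarrow> ('a \<Rightarrow> complex)
    \<Rightarrow> ('a \<otimes> 'a \<Rightarrow> complex) \<Rightarrow> ('a \<otimes> 'a \<Rightarrow> complex) \<Rightarrow> bool"
  where "coquasitriangular_star_bialgebra \<Delta> \<epsilon> r rbar \<longleftrightarrow>
    (let \<Delta>2 = tensor_comult \<Delta> \<Delta>;
         \<Delta>3 = tensor_comult \<Delta> \<Delta>2;
         m = tlift (\<lambda>a b. a * b);
         mop = tlift (\<lambda>a b. b * a)
     in star_bialgebra \<Delta> \<epsilon> \<and> clinear r \<and> clinear rbar \<and>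
        convolve \<Delta>2 (*) r rbar = tlift (\<lambda>a b. \<epsilon> a * \<epsilon> b) \<and>
        convolve \<Delta>2 (*) rbar r = tlift (\<lambda>a b. \<epsilon> a * \<epsilon> b) \<and>
        mop = convolve \<Delta>2 scaleC r (convolve \<Delta>2 (\<lambda>x c. c *\<^sub>C x) m rbar) \<and>
        (\<forall>a b c. r ((a * b) \<otimes> c) =
           convolve \<Delta>3 (*) (leg13 \<epsilon> r) (leg23 \<epsilon> r) (a \<otimes> b \<otimes> c)) \<and>
        (\<forall>a b c. r (a \<otimes> (b * c)) =
           convolve \<Delta>3 (*) (leg13 \<epsilon> r) (leg12 \<epsilon> r) (a \<otimes> b \<otimes> c)) \<and>
        (\<forall>x. r x = cnj (rbar (star_tensor x))))"


section \<open>The braided categories\<close>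

definition is_module :: "('a::star_algebra \<Rightarrow> 'v::complex_vector \<Rightarrow> 'v) \<Rightarrow> bool"
  where "is_module act \<longleftrightarrow> cbilinear act \<and> (\<forall>v. act 1 v = v) \<and>
    (\<forall>a b v. act (a * b) v = act a (act b v))"

definition is_comodule ::
  "('a::complex_vector \<Rightarrow> 'a \<otimes> 'a) \<Rightarrow> ('a \<Rightarrow> complex) \<Rightarrow> ('v::complex_vector \<Rightarrow> 'a \<otimes> 'v) \<Rightarrow> bool"
  where "is_comodule \<Delta> \<epsilon> \<gamma> \<longleftrightarrow> clinear \<gamma> \<and>
    (\<forall>v. assoc (tmap \<Delta> id (\<gamma> v)) = tmap id \<gamma> (\<gamma> v)) \<and>
    (\<forall>v. tlift (\<lambda>a u. \<epsilon> a *\<^sub>C u) (\<gamma> v) = v)"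

definition star_comodule ::
  "('a::star_algebra \<Rightarrow> 'a \<otimes> 'a) \<Rightarrow> ('a \<Rightarrow> complex) \<Rightarrow> ('v::star_vector \<Rightarrow> 'a \<otimes> 'v) \<Rightarrow> bool"
  where "star_comodule \<Delta> \<epsilon> \<gamma> \<longleftrightarrow> is_comodule \<Delta> \<epsilon> \<gamma> \<and> (\<forall>v. \<gamma> (star v) = star_tensor (\<gamma> v))"

definition hopf_object ::
  "('a::star_algebra \<Rightarrow> 'a \<otimes> 'a) \<Rightarrow> ('a \<Rightarrow> complex) \<Rightarrow> ('a \<Rightarrow> 'a)
    \<Rightarrow> ('a \<Rightarrow> 'v::star_vector \<Rightarrow> 'v) \<Rightarrow> ('v \<Rightarrow> 'a \<otimes> 'v) \<Rightarrow> bool"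
  where "hopf_object \<Delta> \<epsilon> S act \<gamma> \<longleftrightarrow> is_module act \<and> star_comodule \<Delta> \<epsilon> \<gamma> \<and>
    (\<forall>a v. tlift (\<lambda>a1 a2. tlift (\<lambda>u v0. (a1 * u) \<otimes> act a2 v0) (\<gamma> v)) (\<Delta> a) =
           tlift (\<lambda>a1 a2. tlift (\<lambda>u v0. (u * a2) \<otimes> v0) (\<gamma> (act a1 v))) (\<Delta> a)) \<and>
    (\<forall>a v. star (act a v) = act (star (S a)) (star v))"

definition induced_action ::
  "('a::complex_vector \<otimes> 'a \<Rightarrow> complex) \<Rightarrow> ('v::complex_vector \<Rightarrow> 'a \<otimes> 'v) \<Rightarrow> 'a \<Rightarrow> 'v \<Rightarrow> 'v"
  where "induced_action rbar \<gamma> a v = tlift (\<lambda>u v0. rbar (a \<otimes> u) *\<^sub>C v0) (\<gamma> v)"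

definition category_object ::
  "('a::star_algebra \<Rightarrow> 'a \<otimes> 'a) \<Rightarrow> ('a \<Rightarrow> complex)
    \<Rightarrow> ('a \<Rightarrow> 'v::star_vector \<Rightarrow> 'v) \<Rightarrow> ('v \<Rightarrow> 'a \<otimes> 'v) \<Rightarrow> bool"
  where "category_object \<Delta> \<epsilon> act \<gamma> \<longleftrightarrow>
    (\<exists>S. hopf_star_algebra \<Delta> \<epsilon> S \<and> hopf_object \<Delta> \<epsilon> S act \<gamma>) \<or>
    (\<exists>r rbar. coquasitriangular_star_bialgebra \<Delta> \<epsilon> r rbar \<and> star_comodule \<Delta> \<epsilon> \<gamma> \<and>
       act = induced_action rbar \<gamma>)"

definition braiding ::
  "('v::complex_vector \<Rightarrow> 'a::complex_vector \<otimes> 'v) \<Rightarrow> ('a \<Rightarrow> 'w::complex_vector \<Rightarrow> 'w)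
    \<Rightarrow> 'v \<otimes> 'w \<Rightarrow> 'w \<otimes> 'v"
  where "braiding \<gamma> act = tlift (\<lambda>v w. tlift (\<lambda>u v0. act u w \<otimes> v0) (\<gamma> v))"

definition tensor_act ::
  "('a::complex_vector \<Rightarrow> 'a \<otimes> 'a) \<Rightarrow> ('a \<Rightarrow> 'v::complex_vector \<Rightarrow> 'v)
    \<Rightarrow> ('a \<Rightarrow> 'w::complex_vector \<Rightarrow> 'w) \<Rightarrow> 'a \<Rightarrow> 'v \<otimes> 'w \<Rightarrow> 'v \<otimes> 'w"
  where "tensor_act \<Delta> act act' a x = tlift (\<lambda>a1 a2. tmap (act a1) (act' a2) x) (\<Delta> a)"

definition tensor_coact ::
  "('v::complex_vector \<Rightarrow> 'a::star_algebra \<otimes> 'v) \<Rightarrow> ('w::complex_vector \<Rightarrow> 'a \<otimes> 'w)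
    \<Rightarrow> 'v \<otimes> 'w \<Rightarrow> 'a \<otimes> ('v \<otimes> 'w)"
  where "tensor_coact \<gamma> \<gamma>' = tlift (\<lambda>v w.
    tlift (\<lambda>a v0. tlift (\<lambda>b w0. (a * b) \<otimes> (v0 \<otimes> w0)) (\<gamma>' w)) (\<gamma> v))"

definition unit_act :: "('a::complex_vector \<Rightarrow> complex) \<Rightarrow> 'a \<Rightarrow> complex \<Rightarrow> complex"
  where "unit_act \<epsilon> a z = \<epsilon> a * z"

definition unit_coact :: "complex \<Rightarrow> 'a::star_algebra \<otimes> complex"
  where "unit_coact z = 1 \<otimes> z"

definition morphism ::
  "('a \<Rightarrow> 'v::complex_vector \<Rightarrow> 'v) \<Rightarrow> ('v \<Rightarrow> 'a::complex_vector \<otimes> 'v)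
    \<Rightarrow> ('a \<Rightarrow> 'w::complex_vector \<Rightarrow> 'w) \<Rightarrow> ('w \<Rightarrow> 'a \<otimes> 'w) \<Rightarrow> ('v \<Rightarrow> 'w) \<Rightarrow> bool"
  where "morphism act \<gamma> act' \<gamma>' f \<longleftrightarrow> clinear f \<and>
    (\<forall>a v. f (act a v) = act' a (f v)) \<and> (\<forall>v. \<gamma>' (f v) = tmap id f (\<gamma> v))"

definition braided_star_bialgebra ::
  "('a::star_algebra \<Rightarrow> 'a \<otimes> 'a) \<Rightarrow> ('a \<Rightarrow> complex)
    \<Rightarrow> ('a \<Rightarrow> 'b::star_algebra \<Rightarrow> 'b) \<Rightarrow> ('b \<Rightarrow> 'a \<otimes> 'b)
    \<Rightarrow> ('b \<Rightarrow> 'b \<otimes> 'b) \<Rightarrow> ('b \<Rightarrow> complex) \<Rightarrow> bool"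
  where "braided_star_bialgebra \<Delta>A \<epsilon>A act \<gamma> \<Delta>B \<epsilon>B \<longleftrightarrow>
    category_object \<Delta>A \<epsilon>A act \<gamma> \<and>
    morphism (tensor_act \<Delta>A act act) (tensor_coact \<gamma> \<gamma>) act \<gamma> (tlift (\<lambda>b c. b * c)) \<and>
    morphism (unit_act \<epsilon>A) unit_coact act \<gamma> (\<lambda>z. z *\<^sub>C 1) \<and>
    morphism act \<gamma> (tensor_act \<Delta>A act act) (tensor_coact \<gamma> \<gamma>) \<Delta>B \<and>
    morphism act \<gamma> (unit_act \<epsilon>A) unit_coact \<epsilon>B \<and>
    star_bialgebra_wrt (braiding \<gamma> act) \<Delta>B \<epsilon>B"


section \<open>Levy processes\<close>

text \<open>The structure maps entering the definition of a Levy process.  They are explicit because the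
  product of the symmetrization depends on the action and the coaction.\<close>

record (overloaded) 'd bialgebra_structure =
  mult_of :: "'d \<Rightarrow> 'd \<Rightarrow> 'd"
  unit_of :: 'd
  star_of :: "'d \<Rightarrow> 'd"
  comult_of :: "'d \<Rightarrow> ('d, 'd) tensor"
  counit_of :: "'d \<Rightarrow> complex"
  braiding_of :: "('d, 'd) tensor \<Rightarrow> ('d, 'd) tensor"

definition braided_structure ::
  "('a::star_algebra \<Rightarrow> 'b::star_algebra \<Rightarrow> 'b) \<Rightarrow> ('b \<Rightarrow> 'a \<otimes> 'b)
    \<Rightarrow> ('b \<Rightarrow> 'b \<otimes> 'b) \<Rightarrow> ('b \<Rightarrow> complex) \<Rightarrow> 'b bialgebra_structure"
  where "braided_structure act \<gamma> \<Delta>B \<epsilon>B =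
    \<lparr>mult_of = (*), unit_of = 1, star_of = star, comult_of = \<Delta>B, counit_of = \<epsilon>B,
     braiding_of = braiding \<gamma> act\<rparr>"

definition symmetrization ::
  "('a::star_algebra \<Rightarrow> 'a \<otimes> 'a) \<Rightarrow> ('a \<Rightarrow> complex)
    \<Rightarrow> ('a \<Rightarrow> 'b::star_algebra \<Rightarrow> 'b) \<Rightarrow> ('b \<Rightarrow> 'a \<otimes> 'b)
    \<Rightarrow> ('b \<Rightarrow> 'b \<otimes> 'b) \<Rightarrow> ('b \<Rightarrow> complex) \<Rightarrow> ('b \<otimes> 'a) bialgebra_structure"
  where "symmetrization \<Delta>A \<epsilon>A act \<gamma> \<Delta>B \<epsilon>B =
    \<lparr>mult_of = (\<lambda>x y. tlift (\<lambda>b a. tlift (\<lambda>d c.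
        tlift (\<lambda>a1 a2. (b * act a1 d) \<otimes> (a2 * c)) (\<Delta>A a)) y) x),
     unit_of = 1 \<otimes> 1,
     star_of = tlift_anti (\<lambda>b a.
        tlift_anti (\<lambda>a1 a2. act (star a1) (star b) \<otimes> star a2) (\<Delta>A a)),
     comult_of = tlift (\<lambda>b a. tlift (\<lambda>b1 b2. tlift (\<lambda>u b20. tlift (\<lambda>a1 a2.
        (b1 \<otimes> (u * a1)) \<otimes> (b20 \<otimes> a2)) (\<Delta>A a)) (\<gamma> b2)) (\<Delta>B b)),
     counit_of = tlift (\<lambda>b a. \<epsilon>B b * \<epsilon>A a),
     braiding_of = flip\<rparr>"

definition state :: "('e::star_algebra \<Rightarrow> complex) \<Rightarrow> bool"
  where "state \<Phi> \<longleftrightarrow> clinear \<Phi> \<and> \<Phi> 1 = 1 \<and>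
    (\<forall>x. Im (\<Phi> (star x * x)) = 0 \<and> Re (\<Phi> (star x * x)) \<ge> 0)"

definition unital_star_hom ::
  "('d::complex_vector) bialgebra_structure \<Rightarrow> ('d \<Rightarrow> 'e::star_algebra) \<Rightarrow> bool"
  where "unital_star_hom D f \<longleftrightarrow> clinear f \<and> f (unit_of D) = 1 \<and>
    (\<forall>x y. f (mult_of D x y) = f x * f y) \<and> (\<forall>x. f (star_of D x) = star (f x))"

text \<open>The tuple \<open>(J 0, \<dots>, J (n - 1))\<close>.\<close>

definition braided_independent ::
  "('d::complex_vector) bialgebra_structure \<Rightarrow> ('e::star_algebra \<Rightarrow> complex)
    \<Rightarrow> nat \<Rightarrow> (nat \<Rightarrow> 'd \<Rightarrow> 'e) \<Rightarrow> bool"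
  where "braided_independent D \<Phi> n J \<longleftrightarrow>
    (\<forall>\<sigma> b. \<sigma> permutes {..<n} \<longrightarrow>
       \<Phi> (prod_list (map (\<lambda>k. J (\<sigma> k) (b k)) [0..<n])) = (\<Prod>k<n. \<Phi> (J (\<sigma> k) (b k)))) \<and>
    (\<forall>k l. k < l \<and> l < n \<longrightarrow> (\<forall>x. tlift (\<lambda>b c. J l b * J k c) x =
       tlift (\<lambda>b c. J k b * J l c) (braiding_of D x)))"

definition levy_process ::
  "('d::complex_vector) bialgebra_structure \<Rightarrow> real \<Rightarrow> ('e::star_algebra \<Rightarrow> complex)
    \<Rightarrow> (real \<Rightarrow> real \<Rightarrow> 'd \<Rightarrow> 'e) \<Rightarrow> bool"
  where "levy_process D T \<Phi> j \<longleftrightarrow> state \<Phi> \<and>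
    (\<forall>s t. 0 \<le> s \<and> s \<le> t \<and> t \<le> T \<longrightarrow> unital_star_hom D (j s t)) \<and>
    (\<forall>r s t. 0 \<le> r \<and> r \<le> s \<and> s \<le> t \<and> t \<le> T \<longrightarrow>
       convolve (comult_of D) (*) (j r s) (j s t) = j r t) \<and>
    (\<forall>t. 0 \<le> t \<and> t \<le> T \<longrightarrow> j t t = (\<lambda>b. counit_of D b *\<^sub>C 1)) \<and>
    (\<forall>n s t. (\<forall>i<n. 0 \<le> s i \<and> s i \<le> t i \<and> t i \<le> T) \<and> (\<forall>i. Suc i < n \<longrightarrow> t i \<le> s (Suc i)) \<longrightarrow>
       braided_independent D \<Phi> n (\<lambda>i. j (s i) (t i))) \<and>
    (\<forall>s t s' t'. 0 \<le> s \<and> s \<le> t \<and> t \<le> T \<and> 0 \<le> s' \<and> s' \<le> t' \<and> t' \<le> T \<and> t - s = t' - s' \<longrightarrow>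
       \<Phi> \<circ> j s t = \<Phi> \<circ> j s' t') \<and>
    (\<forall>b s. 0 \<le> s \<and> s \<le> T \<longrightarrow>
       ((\<lambda>t. \<Phi> (j s t b)) \<longlongrightarrow> counit_of D b) (at s within {s<..T}))"

text \<open>The marginals determine \<open>\<phi> u\<close> for \<open>0 \<le> u \<le> T\<close>, and there they satisfy the semigroup law.
  The values \<open>\<phi> u\<close> with \<open>u > T\<close> are not tied to the process and are left unconstrained.\<close>

definition has_convolution_semigroup ::
  "real \<Rightarrow> ('e \<Rightarrow> complex) \<Rightarrow> (real \<Rightarrow> real \<Rightarrow> 'd \<Rightarrow> 'e) \<Rightarrow> (real \<Rightarrow> 'd \<Rightarrow> complex) \<Rightarrow> bool"
  where "has_convolution_semigroup T \<Phi> j \<phi> \<longleftrightarrow>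
    (\<forall>s t. 0 \<le> s \<and> s \<le> t \<and> t \<le> T \<longrightarrow> \<Phi> \<circ> j s t = \<phi> (t - s))"

text \<open>The intervals in a joint moment are arbitrary; they may overlap and come in any order.\<close>

definition equivalent_processes ::
  "real \<Rightarrow> ('e::star_algebra \<Rightarrow> complex) \<Rightarrow> (real \<Rightarrow> real \<Rightarrow> 'd \<Rightarrow> 'e)
    \<Rightarrow> ('f::star_algebra \<Rightarrow> complex) \<Rightarrow> (real \<Rightarrow> real \<Rightarrow> 'd \<Rightarrow> 'f) \<Rightarrow> bool"
  where "equivalent_processes T \<Phi> j \<Phi>' j' \<longleftrightarrow>
    (\<forall>xs. (\<forall>(s, t, b) \<in> set xs. 0 \<le> s \<and> s \<le> t \<and> t \<le> T) \<longrightarrow>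
       \<Phi> (prod_list (map (\<lambda>(s, t, b). j s t b) xs)) =
       \<Phi>' (prod_list (map (\<lambda>(s, t, b). j' s t b) xs)))"

definition extend_functional ::
  "('a::complex_vector \<Rightarrow> complex) \<Rightarrow> ('b::complex_vector \<Rightarrow> complex) \<Rightarrow> 'b \<otimes> 'a \<Rightarrow> complex"
  where "extend_functional \<epsilon>A \<phi> = tlift (\<lambda>b a. \<phi> b * \<epsilon>A a)"

definition hat_process ::
  "('b::star_algebra \<Rightarrow> 'a::star_algebra \<otimes> 'b) \<Rightarrow> (real \<Rightarrow> real \<Rightarrow> 'b \<otimes> 'a \<Rightarrow> 'e::star_algebra)
    \<Rightarrow> real \<Rightarrow> real \<Rightarrow> 'b \<Rightarrow> 'e"
  where "hat_process \<gamma> jH s t b = tlift (\<lambda>u b0. jH 0 s (1 \<otimes> u) * jH s t (b0 \<otimes> 1)) (\<gamma> b)"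

end

theory Submission
  imports Defs
begin

text \<open>
  Write \<open>I s t a = jH s t (1 \<otimes> a)\<close> and \<open>K s t b = jH s t (b \<otimes> 1)\<close>, so that
  \<open>hat s t b\<close> is the Sweedler sum \<open>I 0 s b\<^sub>(\<^sub>-\<^sub>1\<^sub>) * K s t b\<^sub>(\<^sub>0\<^sub>)\<close>.  Increments of \<open>jH\<close> over disjoint intervals
  commute, and the Yetter-Drinfeld condition turns \<open>I 0 w a * hat s t b\<close> with \<open>t \<le> w\<close> into
  \<open>hat s t (a\<^sub>(\<^sub>1\<^sub>) \<cdot> b) * I 0 w a\<^sub>(\<^sub>2\<^sub>)\<close>; hence the increments of \<open>hat\<close> satisfy the braided commutation
  relations.  Since the marginals of \<open>jH\<close> are \<open>\<phi> \<otimes> \<epsilon>A\<close>, a factor \<open>I 0 s a\<close> to the right of a product over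
  earlier intervals contributes only \<open>\<epsilon>A a\<close> to the expectation, so moments of \<open>hat\<close> in increasing time
  order factor into values of \<open>\<phi>\<close>, as they do for \<open>j\<close>.

  Arbitrary moments of both processes reduce to ordered ones over a common refinement, by the
  convolution and commutation relations that the two processes share; this gives equivalence.
  Independence in every order, stationarity and continuity of \<open>hat\<close> are then read off from \<open>j\<close>.
\<close>


section \<open>Sweedler calculus\<close>

text \<open>\<open>tlift\<close> is a definite description, so its equations are available only for
  bilinear integrands. These introduction rules let \<open>intro lin\<close> discharge that side
  condition; rules for concrete maps are added locally under names such as
  \<open>lin'\<close>.\<close>

named_theorems lin

lemma cbilinearI [lin]:
  "\<lbrakk>\<And>w. clinear (\<lambda>v. f v w); \<And>v. clinear (\<lambda>w. f v w)\<rbrakk> \<Longrightarrow> cbilinear f"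
  by (simp add: cbilinear_def)

lemma cbilinearD:
  assumes "cbilinear f"
  shows "clinear (\<lambda>v. f v w)" "clinear (\<lambda>w. f v w)"
  using assms by (simp_all add: cbilinear_def)

lemma clinear_compose: "\<lbrakk>clinear f; clinear g\<rbrakk> \<Longrightarrow> clinear (\<lambda>x. f (g x))"
  by (simp add: clinear_iff)

lemma clinear_ident [lin]: "clinear (\<lambda>x. x)"
  by (simp add: clinear_iff)

lemma clinear_times_left [lin]: "clinear f \<Longrightarrow> clinear (\<lambda>x. f x * (c :: 'a::star_algebra))"
  by (simp add: clinear_iff distrib_right scaleC_mult_left)

lemma clinear_times_right [lin]: "clinear f \<Longrightarrow> clinear (\<lambda>x. (c :: 'a::star_algebra) * f x)"
  by (simp add: clinear_iff distrib_left scaleC_mult_right)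

lemma clinear_scaleC_left [lin]: "clinear f \<Longrightarrow> clinear (\<lambda>x. f x *\<^sub>C c)"
  by (simp add: clinear_iff scaleC_add_left scaleC_scaleC scaleC_complex_def)

lemma clinear_scaleC_right [lin]: "clinear f \<Longrightarrow> clinear (\<lambda>x. c *\<^sub>C f x)"
  by (simp add: clinear_iff scaleC_add_right scaleC_scaleC mult.commute)

lemma clinear_tensor_left [lin]: "clinear f \<Longrightarrow> clinear (\<lambda>x. f x \<otimes> c)"
  by (simp add: clinear_iff tensor_add_left tensor_scaleC_left)

lemma clinear_tensor_right [lin]: "clinear f \<Longrightarrow> clinear (\<lambda>x. c \<otimes> f x)"
  by (simp add: clinear_iff tensor_add_right tensor_scaleC_right)

lemma clinear_tlift_arg [lin]: "\<lbrakk>cbilinear f; clinear g\<rbrakk> \<Longrightarrow> clinear (\<lambda>x. tlift f (g x))"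
  by (rule clinear_compose[OF clinear_tlift])

lemma clinear_zero: "clinear f \<Longrightarrow> f 0 = 0"
  unfolding clinear_iff by (metis add_cancel_right_right)

lemma tensor_ext:
  assumes "clinear f" "clinear g" "\<And>v w. f (v \<otimes> w) = g (v \<otimes> w)"
  shows "f x = g x"
  using tensor_map_unique[of f g] assms by (simp add: clinear_iff)

text \<open>Here a parameter of the integrand varies, not the tensor as in
  \<open>clinear_tlift_arg\<close>. A Sweedler sum is a finite sum of values \<open>F x v w\<close>,
  so induction over \<open>t\<close> applies.\<close>

lemma clinear_tlift_fun [lin]:
  assumes "\<And>x. cbilinear (F x)" "\<And>a b. clinear (\<lambda>x. F x a b)"
  shows "clinear (\<lambda>x. tlift (F x) t)"
proof (induction t rule: tensor_induct)
  case zero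
  then show ?case by (simp add: clinear_zero[OF clinear_tlift[OF assms(1)]] clinear_iff)
next
  case (add t v w)
  have "tlift (F x) (t + v \<otimes> w) = tlift (F x) t + F x v w" for x
    using clinear_tlift[OF assms(1), of x] tlift_tensor[OF assms(1)] by (simp add: clinear_iff)
  with add assms(2)[of v w] show ?case by (simp add: clinear_iff algebra_simps scaleC_add_right)
qed

lemmas cbilinear_compose_left = clinear_compose[OF cbilinearD(1)]
lemmas cbilinear_compose_right = clinear_compose[OF cbilinearD(2)]

section \<open>Exchange rules for Sweedler sums\<close>

lemma tlift_linear:
  assumes "clinear g" "cbilinear f"
  shows "g (tlift f x) = tlift (\<lambda>v w. g (f v w)) x"
proof -
  have b: "cbilinear (\<lambda>v w. g (f v w))"
    by (intro cbilinearI clinear_compose[OF assms(1)] cbilinearD[OF assms(2)])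
  show ?thesis
    by (rule tensor_ext)
      (intro lin clinear_compose[OF assms(1)] assms b | simp add: tlift_tensor[OF b] tlift_tensor[OF assms(2)])+
qed

lemma
  fixes f :: "'v::complex_vector \<Rightarrow> 'w::complex_vector \<Rightarrow> 'x::star_algebra"
  assumes "cbilinear f"
  shows times_tlift: "c * tlift f x = tlift (\<lambda>v w. c * f v w) x"
    and tlift_times: "tlift f x * c = tlift (\<lambda>v w. f v w * c) x"
  by (rule tlift_linear[OF _ assms], intro lin)+

lemma scaleC_tlift: "cbilinear f \<Longrightarrow> c *\<^sub>C tlift f x = tlift (\<lambda>v w. c *\<^sub>C f v w) x"
  by (rule tlift_linear, intro lin)

lemma
  assumes "cbilinear f"
  shows tensor_tlift: "c \<otimes> tlift f x = tlift (\<lambda>v w. c \<otimes> f v w) x"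
    and tlift_tensor_of: "tlift f x \<otimes> c = tlift (\<lambda>v w. f v w \<otimes> c) x"
  by (rule tlift_linear[OF _ assms], intro lin)+

lemma tlift_tlift:
  assumes "cbilinear f" "cbilinear g"
  shows "tlift f (tlift g x) = tlift (\<lambda>v w. tlift f (g v w)) x"
  by (rule tlift_linear[OF clinear_tlift]) (rule assms)+

text \<open>Fubini for Sweedler sums, neither tensor depending on the legs of the other. On a pure
  tensor \<open>x\<close> both sides reduce to one sum over \<open>y\<close>.\<close>

lemma tlift_swap:
  assumes "\<And>b c d. clinear (\<lambda>a. F a b c d)" "\<And>a c d. clinear (\<lambda>b. F a b c d)"
    "\<And>a b d. clinear (\<lambda>c. F a b c d)" "\<And>a b c. clinear (\<lambda>d. F a b c d)"
  shows "tlift (\<lambda>a b. tlift (\<lambda>c d. F a b c d) y) x = tlift (\<lambda>c d. tlift (\<lambda>a b. F a b c d) x) y"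
proof (rule tensor_ext[where x = x])
  fix v w
  show "tlift (\<lambda>a b. tlift (F a b) y) (v \<otimes> w) = tlift (\<lambda>c d. tlift (\<lambda>a b. F a b c d) (v \<otimes> w)) y"
    by (subst tlift_tensor | intro lin assms | simp)+
qed (intro lin assms)+

lemma clinear_tmap [lin]:
  "\<lbrakk>clinear f; clinear g; clinear h\<rbrakk> \<Longrightarrow> clinear (\<lambda>x. tmap f g (h x))"
  unfolding tmap_def by (intro lin | assumption)+

lemma tmap_tensor: "\<lbrakk>clinear f; clinear g\<rbrakk> \<Longrightarrow> tmap f g (v \<otimes> w) = f v \<otimes> g w"
  unfolding tmap_def by (subst tlift_tensor) (intro lin | assumption | simp)+

lemma tlift_tmap:
  assumes "clinear f" "clinear g" "cbilinear F"
  shows "tlift F (tmap f g x) = tlift (\<lambda>a b. F (f a) (g b)) x"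
  unfolding tmap_def
  by (subst tlift_tlift) (intro lin assms | simp add: tlift_tensor[OF assms(3)])+

section \<open>Coassociativity and counit laws\<close>

lemma clinear_assoc: "clinear assoc"
  unfolding assoc_def by (intro lin)

lemma tlift_assoc:
  assumes "\<And>b c. clinear (\<lambda>a. F a b c)" "\<And>a c. clinear (\<lambda>b. F a b c)" "\<And>a b. clinear (\<lambda>c. F a b c)"
  shows "tlift (\<lambda>a. tlift (F a)) (assoc x) = tlift (\<lambda>y c. tlift (\<lambda>a b. F a b c) y) x"
proof -
  have b: "cbilinear (\<lambda>a. tlift (F a))" "cbilinear (F a)" "cbilinear (\<lambda>a b. F a b c)" for a c
    by (intro lin assms)+
  show ?thesis
    unfolding assoc_def
    by (subst tlift_tlift, (intro lin b)+, subst tlift_tlift, (intro lin b)+)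
      (simp add: tlift_tensor[OF b(1)] tlift_tensor[OF b(2)])
qed

text \<open>Both sides are the lift of \<open>F\<close> over the two sides of the coassociativity
  axiom. In this form the law can be applied inside any nested Sweedler sum.\<close>

lemma comodule_coassoc:
  assumes "is_comodule \<Delta> \<epsilon> \<gamma>" "clinear \<Delta>"
    and "\<And>b c. clinear (\<lambda>a. F a b c)" "\<And>a c. clinear (\<lambda>b. F a b c)" "\<And>a b. clinear (\<lambda>c. F a b c)"
  shows "tlift (\<lambda>a c. tlift (\<lambda>a1 a2. F a1 a2 c) (\<Delta> a)) (\<gamma> v)
    = tlift (\<lambda>a1 c. tlift (\<lambda>a2 c. F a1 a2 c) (\<gamma> c)) (\<gamma> v)"
proof -
  have \<gamma>: "clinear \<gamma>" using assms(1) by (simp add: is_comodule_def)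
  have "tlift (\<lambda>a c. tlift (\<lambda>a1 a2. F a1 a2 c) (\<Delta> a)) (\<gamma> v)
    = tlift (\<lambda>a. tlift (F a)) (assoc (tmap \<Delta> id (\<gamma> v)))"
    by (simp add: tlift_assoc[OF assms(3-5)] id_def)
      (subst tlift_tmap, (intro lin assms)+, simp)
  also have "\<dots> = tlift (\<lambda>a. tlift (F a)) (tmap id \<gamma> (\<gamma> v))"
    using assms(1) by (simp add: is_comodule_def)
  also have "\<dots> = tlift (\<lambda>a1 c. tlift (\<lambda>a2 c. F a1 a2 c) (\<gamma> c)) (\<gamma> v)"
    unfolding id_def by (subst tlift_tmap, (intro lin assms \<gamma>)+, simp)
  finally show ?thesis .
qed

lemma comodule_counit:
  assumes "is_comodule \<Delta> \<epsilon> \<gamma>" "clinear \<epsilon>" "clinear f"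
  shows "tlift (\<lambda>a c. \<epsilon> a *\<^sub>C f c) (\<gamma> v) = f v"
proof -
  have "f v = f (tlift (\<lambda>a c. \<epsilon> a *\<^sub>C c) (\<gamma> v))"
    using assms(1) by (simp add: is_comodule_def)
  also have "\<dots> = tlift (\<lambda>a c. \<epsilon> a *\<^sub>C f c) (\<gamma> v)"
    by (subst tlift_linear[OF assms(3)], (intro lin assms)+)
      (use assms(3) in \<open>simp add: clinear_iff\<close>)
  finally show ?thesis ..
qed

text \<open>A coalgebra coacts on itself from the left, so \<open>coassoc\<close> and
  \<open>counit_left\<close> are instances of the comodule laws. The right counit law is not an
  instance and gets its own proof.\<close>

lemma coalgebra_comodule: "coalgebra \<Delta> \<epsilon> \<Longrightarrow> is_comodule \<Delta> \<epsilon> \<Delta>"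
  by (simp add: coalgebra_def is_comodule_def)

lemmas coassoc = comodule_coassoc[OF coalgebra_comodule]
lemmas counit_left = comodule_counit[OF coalgebra_comodule]

lemma counit_right:
  assumes "coalgebra \<Delta> \<epsilon>" "clinear f"
  shows "tlift (\<lambda>a c. \<epsilon> c *\<^sub>C f a) (\<Delta> v) = f v"
proof -
  have \<epsilon>: "clinear \<epsilon>" using assms(1) by (simp add: coalgebra_def)
  have "f v = f (tlift (\<lambda>a c. \<epsilon> c *\<^sub>C a) (\<Delta> v))"
    using assms(1) by (simp add: coalgebra_def)
  also have "\<dots> = tlift (\<lambda>a c. \<epsilon> c *\<^sub>C f a) (\<Delta> v)"
    by (subst tlift_linear[OF assms(2)], (intro lin assms \<epsilon>)+)
      (use assms(2) in \<open>simp add: clinear_iff\<close>)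
  finally show ?thesis ..
qed


section \<open>The braided category\<close>

lemma clinear_tensor_comult [lin]:
  assumes "clinear \<Delta>" "clinear \<Delta>'" "clinear f"
  shows "clinear (\<lambda>x. tensor_comult \<Delta> \<Delta>' (f x))"
  unfolding tensor_comult_def by (intro lin assms clinear_compose[OF assms(1)] clinear_compose[OF assms(2)])

lemma tensor_comult_tensor:
  assumes "clinear \<Delta>" "clinear \<Delta>'"
  shows "tensor_comult \<Delta> \<Delta>' (c \<otimes> d)
    = tlift (\<lambda>c1 c2. tlift (\<lambda>d1 d2. (c1 \<otimes> d1) \<otimes> (c2 \<otimes> d2)) (\<Delta>' d)) (\<Delta> c)"
  unfolding tensor_comult_def
  by (subst tlift_tensor) (intro lin assms clinear_compose[OF assms(1)] clinear_compose[OF assms(2)] refl)+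

lemma tlift_tensor_comult:
  assumes "clinear \<Delta>" "clinear \<Delta>'" "cbilinear F"
  shows "tlift F (tensor_comult \<Delta> \<Delta>' (c \<otimes> d))
    = tlift (\<lambda>c1 c2. tlift (\<lambda>d1 d2. F (c1 \<otimes> d1) (c2 \<otimes> d2)) (\<Delta>' d)) (\<Delta> c)"
proof -
  show ?thesis
    unfolding tensor_comult_tensor[OF assms(1,2)]
    by (subst tlift_tlift, (intro lin assms)+, subst tlift_tlift, (intro lin assms)+,
        subst tlift_tensor[OF assms(3)], rule refl)
qed

lemma tensor_comult_coassoc:
  assumes co: "coalgebra \<Delta> \<epsilon>" "coalgebra \<Delta>' \<epsilon>'"
  shows "assoc (tmap (tensor_comult \<Delta> \<Delta>') id (tensor_comult \<Delta> \<Delta>' x))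
    = tmap id (tensor_comult \<Delta> \<Delta>') (tensor_comult \<Delta> \<Delta>' x)" (is "?l x = ?r x")
proof -
  have \<Delta>: "clinear \<Delta>" "clinear \<Delta>'" using co by (auto simp: coalgebra_def)
  note lin\<Delta> = lin clinear_compose[OF \<Delta>(1)] clinear_compose[OF \<Delta>(2)] clinear_compose[OF clinear_assoc]
    clinear_tmap[of _ "\<lambda>x. x"] clinear_tmap[of "\<lambda>x. x"]
  let ?D = "tensor_comult \<Delta> \<Delta>'"
  have D: "clinear ?D" by (intro lin \<Delta>)
  show ?thesis
  proof (rule tensor_ext[of ?l ?r])
    show "clinear ?l" "clinear ?r" unfolding id_def by (intro lin\<Delta> \<Delta> D)+
    fix c d
    have "?l (c \<otimes> d) = tlift (\<lambda>z w. tlift (\<lambda>u v. u \<otimes> v \<otimes> w) (?D z)) (?D (c \<otimes> d))"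
      unfolding assoc_def id_def
      by (subst tlift_tmap, (intro lin\<Delta> \<Delta> D)+, rule refl)
    also have "\<dots> = tlift (\<lambda>c1 c2. tlift (\<lambda>d1 d2. tlift (\<lambda>c11 c12. tlift (\<lambda>d11 d12.
        (c11 \<otimes> d11) \<otimes> (c12 \<otimes> d12) \<otimes> (c2 \<otimes> d2)) (\<Delta>' d1)) (\<Delta> c1)) (\<Delta>' d)) (\<Delta> c)"
      by (simp add: tlift_tensor_comult \<Delta> lin\<Delta>)
    \<comment> \<open>The sums over \<open>c\<close> and \<open>d\<close> are interlaced. The swap
      separates them, so that coassociativity applies to each coalgebra in turn; a second swap
      restores the interlaced order.\<close>
    also have "\<dots> = tlift (\<lambda>c1 c2. tlift (\<lambda>c11 c12. tlift (\<lambda>d1 d2. tlift (\<lambda>d11 d12.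
        (c11 \<otimes> d11) \<otimes> (c12 \<otimes> d12) \<otimes> (c2 \<otimes> d2)) (\<Delta>' d1)) (\<Delta>' d)) (\<Delta> c1)) (\<Delta> c)"
      by (subst tlift_swap, (intro lin\<Delta>)+, rule refl)
    also have "\<dots> = tlift (\<lambda>c1 c2. tlift (\<lambda>c21 c22. tlift (\<lambda>d1 d2. tlift (\<lambda>d21 d22.
        (c1 \<otimes> d1) \<otimes> (c21 \<otimes> d21) \<otimes> (c22 \<otimes> d22)) (\<Delta>' d2)) (\<Delta>' d)) (\<Delta> c2)) (\<Delta> c)"
      by (subst coassoc[OF co(1) \<Delta>(1)], (intro lin\<Delta>)+)
        (subst coassoc[OF co(2) \<Delta>(2)], (intro lin\<Delta>)+, rule refl)
    also have "\<dots> = tlift (\<lambda>c1 c2. tlift (\<lambda>d1 d2. tlift (\<lambda>c21 c22. tlift (\<lambda>d21 d22.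
        (c1 \<otimes> d1) \<otimes> (c21 \<otimes> d21) \<otimes> (c22 \<otimes> d22)) (\<Delta>' d2)) (\<Delta> c2)) (\<Delta>' d)) (\<Delta> c)"
      by (subst (2) tlift_swap, (intro lin\<Delta>)+, rule refl)
    also have "\<dots> = tlift (\<lambda>z w. z \<otimes> ?D w) (?D (c \<otimes> d))"
      by (subst tlift_tensor_comult[OF \<Delta>], (intro lin\<Delta> \<Delta>)+)
        (simp add: tensor_comult_tensor tensor_tlift \<Delta> lin\<Delta>)
    also have "\<dots> = ?r (c \<otimes> d)"
      unfolding tmap_def id_def ..
    finally show "?l (c \<otimes> d) = ?r (c \<otimes> d)" .
  qed
qed

lemma tensor_comult_counit:
  assumes co: "coalgebra \<Delta> \<epsilon>" "coalgebra \<Delta>' \<epsilon>'"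
  shows "tlift (\<lambda>x y. tlift (\<lambda>a b. \<epsilon> a * \<epsilon>' b) x *\<^sub>C y) (tensor_comult \<Delta> \<Delta>' z) = z"
    (is "?l z = z")
    and "tlift (\<lambda>x y. tlift (\<lambda>a b. \<epsilon> a * \<epsilon>' b) y *\<^sub>C x) (tensor_comult \<Delta> \<Delta>' z) = z"
    (is "?r z = z")
proof -
  have \<Delta>: "clinear \<Delta>" "clinear \<Delta>'" "clinear \<epsilon>" "clinear \<epsilon>'" using co by (auto simp: coalgebra_def)
  note lin\<Delta> = lin clinear_compose[OF \<Delta>(1)] clinear_compose[OF \<Delta>(2)] clinear_compose[OF \<Delta>(3)]
    clinear_compose[OF \<Delta>(4)]
  have b: "cbilinear (\<lambda>a b. \<epsilon> a * \<epsilon>' b)" by (intro lin\<Delta>)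
  show "?l z = z"
  proof (rule tensor_ext[of ?l "\<lambda>z. z"])
    fix c d
    have "?l (c \<otimes> d) = tlift (\<lambda>c1 c2. tlift (\<lambda>d1 d2. \<epsilon> c1 *\<^sub>C (\<epsilon>' d1 *\<^sub>C (c2 \<otimes> d2))) (\<Delta>' d)) (\<Delta> c)"
      by (subst tlift_tensor_comult[OF \<Delta>(1,2)], (intro lin\<Delta>)+)
        (simp only: tlift_tensor[OF b] scaleC_scaleC)
    also have "\<dots> = tlift (\<lambda>c1 c2. \<epsilon> c1 *\<^sub>C (c2 \<otimes> d)) (\<Delta> c)"
      by (subst scaleC_tlift[symmetric], (intro lin\<Delta>)+,
          subst counit_left[OF co(2) \<Delta>(4)], (intro lin\<Delta>)+, rule refl)
    also have "\<dots> = c \<otimes> d"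
      by (rule counit_left[OF co(1) \<Delta>(3)]) (intro lin\<Delta>)
    finally show "?l (c \<otimes> d) = c \<otimes> d" .
  qed (intro lin\<Delta> \<Delta>)+
  show "?r z = z"
  proof (rule tensor_ext[of ?r "\<lambda>z. z"])
    fix c d
    have "?r (c \<otimes> d) = tlift (\<lambda>c1 c2. tlift (\<lambda>d1 d2. \<epsilon> c2 *\<^sub>C (\<epsilon>' d2 *\<^sub>C (c1 \<otimes> d1))) (\<Delta>' d)) (\<Delta> c)"
      by (subst tlift_tensor_comult[OF \<Delta>(1,2)], (intro lin\<Delta>)+)
        (simp only: tlift_tensor[OF b] scaleC_scaleC)
    also have "\<dots> = tlift (\<lambda>c1 c2. \<epsilon> c2 *\<^sub>C (c1 \<otimes> d)) (\<Delta> c)"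
      by (subst scaleC_tlift[symmetric], (intro lin\<Delta>)+,
          subst counit_right[OF co(2)], (intro lin\<Delta>)+, rule refl)
    also have "\<dots> = c \<otimes> d"
      by (rule counit_right[OF co(1)]) (intro lin\<Delta>)
    finally show "?r (c \<otimes> d) = c \<otimes> d" .
  qed (intro lin\<Delta> \<Delta>)+
qed

lemma coalgebra_tensor_comult:
  assumes "coalgebra \<Delta> \<epsilon>" "coalgebra \<Delta>' \<epsilon>'"
  shows "coalgebra (tensor_comult \<Delta> \<Delta>') (tlift (\<lambda>a b. \<epsilon> a * \<epsilon>' b))"
proof -
  have \<Delta>: "clinear \<Delta>" "clinear \<Delta>'" "clinear \<epsilon>" "clinear \<epsilon>'"
    using assms by (auto simp: coalgebra_def)
  show ?thesis
    unfolding coalgebra_def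
    using tensor_comult_coassoc[OF assms] tensor_comult_counit[OF assms]
    by (simp add: lin clinear_compose[OF \<Delta>(3)] clinear_compose[OF \<Delta>(4)] \<Delta>
        clinear_tensor_comult[of \<Delta> \<Delta>' "\<lambda>x. x"] clinear_tlift_arg[of _ "\<lambda>x. x"])
qed

text \<open>The first two factors are scalar-valued, the last one is vector-valued. This covers
  products of functionals as well as \<open>rbar\<close> convolved with the algebra-valued
  \<open>mop\<close>.\<close>

lemma convolve_assoc:
  fixes f h :: "'c::complex_vector \<Rightarrow> complex" and g :: "'c \<Rightarrow> 'z::complex_vector"
  assumes co: "coalgebra \<Delta> \<epsilon>" and lin_fgh: "clinear f" "clinear h" "clinear g"
  shows "convolve \<Delta> (*\<^sub>C) f (convolve \<Delta> (*\<^sub>C) h g) = convolve \<Delta> (*\<^sub>C) (convolve \<Delta> (*) f h) g"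
proof
  fix x
  have \<Delta>: "clinear \<Delta>" using co by (auto simp: coalgebra_def)
  note lin' = lin clinear_compose[OF \<Delta>] clinear_compose[OF lin_fgh(1)] clinear_compose[OF lin_fgh(2)]
    clinear_compose[OF lin_fgh(3)]
  have "convolve \<Delta> (*\<^sub>C) f (convolve \<Delta> (*\<^sub>C) h g) x
    = tlift (\<lambda>a y. tlift (\<lambda>b c. (f a * h b) *\<^sub>C g c) (\<Delta> y)) (\<Delta> x)"
    unfolding convolve_def
    by (subst scaleC_tlift, (intro lin')+) (simp add: scaleC_scaleC)
  also have "\<dots> = tlift (\<lambda>y c. tlift (\<lambda>a b. (f a * h b) *\<^sub>C g c) (\<Delta> y)) (\<Delta> x)"
    by (rule coassoc[OF co \<Delta>, symmetric]) (intro lin')+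
  also have "\<dots> = convolve \<Delta> (*\<^sub>C) (convolve \<Delta> (*) f h) g x"
    unfolding convolve_def
    by (subst tlift_linear[where g = "\<lambda>z. z *\<^sub>C _"], (intro lin')+, rule refl)
  finally show "convolve \<Delta> (*\<^sub>C) f (convolve \<Delta> (*\<^sub>C) h g) x
    = convolve \<Delta> (*\<^sub>C) (convolve \<Delta> (*) f h) g x" .
qed


section \<open>Consequences of the coquasi-triangular axioms\<close>

lemma tlift_tensor_comult_one:
  fixes \<Delta> :: "'a::star_algebra \<Rightarrow> 'a \<otimes> 'a"
  assumes "clinear \<Delta>" "clinear \<Delta>'" "cbilinear F" "\<Delta> 1 = 1 \<otimes> 1"
  shows "tlift F (tensor_comult \<Delta> \<Delta>' (1 \<otimes> d)) = tlift (\<lambda>d1 d2. F (1 \<otimes> d1) (1 \<otimes> d2)) (\<Delta>' d)"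
proof -
  note lin_F = cbilinear_compose_left[OF assms(3)] cbilinear_compose_right[OF assms(3)]
  show ?thesis
    unfolding tlift_tensor_comult[OF assms(1-3)] assms(4)
    by (subst tlift_tensor, (intro lin lin_F)+, rule refl)
qed

text \<open>Since 1 is group-like, \<open>f\<close>, given by \<open>r (1 \<otimes> c)\<close>, has
  the convolution inverse \<open>g\<close>, given by \<open>rbar (1 \<otimes> c)\<close>. The axiom
  for \<open>r\<close> on a product, taken at \<open>1 * 1\<close>, makes \<open>f\<close>
  idempotent. An invertible idempotent is the unit, so \<open>f\<close> and then \<open>g\<close>
  equal \<open>\<epsilon>\<close>. This yields the unit law of the induced action.\<close>

lemma rbar_one:
  assumes "coquasitriangular_star_bialgebra \<Delta> \<epsilon> r rbar"
  shows "rbar (1 \<otimes> c) = \<epsilon> c"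
proof -
  define \<Delta>2 where "\<Delta>2 = tensor_comult \<Delta> \<Delta>"
  have co: "coalgebra \<Delta> \<epsilon>" and one: "\<Delta> 1 = 1 \<otimes> 1" "\<epsilon> 1 = 1" and r: "clinear r" "clinear rbar"
    and inv: "convolve \<Delta>2 (*) r rbar = tlift (\<lambda>a b. \<epsilon> a * \<epsilon> b)"
      "convolve \<Delta>2 (*) rbar r = tlift (\<lambda>a b. \<epsilon> a * \<epsilon> b)"
    and mult: "r ((a * b) \<otimes> c) = convolve (tensor_comult \<Delta> \<Delta>2) (*) (leg13 \<epsilon> r) (leg23 \<epsilon> r) (a \<otimes> b \<otimes> c)" for a b c
    using assms
    by (auto simp: coquasitriangular_star_bialgebra_def Let_def star_bialgebra_def
        star_bialgebra_wrt_def \<Delta>2_def)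
  have \<Delta>: "clinear \<Delta>" "clinear \<epsilon>" using co by (auto simp: coalgebra_def)
  have \<Delta>2: "clinear \<Delta>2" unfolding \<Delta>2_def by (intro lin \<Delta>)
  note lin' = lin clinear_compose[OF \<Delta>(1)] clinear_compose[OF \<Delta>(2)] clinear_compose[OF r(1)] clinear_compose[OF r(2)]
  define f g where "f = (\<lambda>c. r (1 \<otimes> c))" and "g = (\<lambda>c. rbar (1 \<otimes> c))"
  have fg: "clinear f" "clinear g" unfolding f_def g_def by (intro lin')+
  have scale: "((*\<^sub>C) :: complex \<Rightarrow> complex \<Rightarrow> complex) = (*)"
    by (simp add: fun_eq_iff scaleC_complex_def)
  have eps: "tlift (\<lambda>a b. \<epsilon> a * \<epsilon> b) (1 \<otimes> c) = \<epsilon> c" for c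
    by (subst tlift_tensor) (intro lin' | simp add: one)+
  have "convolve \<Delta>2 (*) r rbar (1 \<otimes> c) = convolve \<Delta> (*) f g c" for c
    unfolding convolve_def \<Delta>2_def f_def g_def
    by (subst tlift_tensor_comult_one[OF \<Delta>(1,1)]) (intro lin' | simp add: one)+
  then have f_g: "convolve \<Delta> (*) f g = \<epsilon>" using eps inv by (simp add: fun_eq_iff)
  have "convolve \<Delta>2 (*) rbar r (1 \<otimes> c) = convolve \<Delta> (*) g f c" for c
    unfolding convolve_def \<Delta>2_def f_def g_def
    by (subst tlift_tensor_comult_one[OF \<Delta>(1,1)]) (intro lin' | simp add: one)+
  then have g_f: "convolve \<Delta> (*) g f = \<epsilon>" using eps inv by (simp add: fun_eq_iff)
  have legs: "leg13 \<epsilon> r (1 \<otimes> 1 \<otimes> c) = f c" "leg23 \<epsilon> r (1 \<otimes> 1 \<otimes> c) = f c" for c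
    unfolding leg13_def leg23_def f_def
    by ((subst tlift_tensor, (intro lin')+)+, simp add: one)+
  have lin_legs: "clinear h \<Longrightarrow> clinear (\<lambda>x. leg13 \<epsilon> r (h x))"
    "clinear h \<Longrightarrow> clinear (\<lambda>x. leg23 \<epsilon> r (h x))" for h :: "'x::complex_vector \<Rightarrow> _"
    unfolding leg13_def leg23_def by (intro lin', assumption)+
  have f_f: "f = convolve \<Delta> (*) f f"
  proof
    fix c
    \<comment> \<open>Group-likeness of 1 is used twice, to strip two legs from the coproduct on
      three legs.\<close>
    have "f c = tlift (\<lambda>x y. leg13 \<epsilon> r x * leg23 \<epsilon> r y) (tensor_comult \<Delta> \<Delta>2 (1 \<otimes> 1 \<otimes> c))"
      using mult[of 1 1 c] by (simp add: f_def convolve_def)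
    also have "\<dots> = tlift (\<lambda>x y. leg13 \<epsilon> r (1 \<otimes> x) * leg23 \<epsilon> r (1 \<otimes> y)) (\<Delta>2 (1 \<otimes> c))"
      by (rule tlift_tensor_comult_one[OF \<Delta>(1) \<Delta>2 _ one(1)]) (intro lin' lin_legs)
    also have "\<dots> = tlift (\<lambda>x y. leg13 \<epsilon> r (1 \<otimes> 1 \<otimes> x) * leg23 \<epsilon> r (1 \<otimes> 1 \<otimes> y)) (\<Delta> c)"
      unfolding \<Delta>2_def
      by (rule tlift_tensor_comult_one[OF \<Delta>(1) \<Delta>(1) _ one(1)]) (intro lin' lin_legs)
    finally show "f c = convolve \<Delta> (*) f f c" by (simp add: legs convolve_def)
  qed
  have unit: "convolve \<Delta> (*) \<epsilon> h = h" if "clinear h" for h :: "'a \<Rightarrow> complex"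
    using counit_left[OF co \<Delta>(2) that] by (simp add: fun_eq_iff convolve_def scale)
  have "f = convolve \<Delta> (*) (convolve \<Delta> (*) g f) f" by (simp add: g_f unit fg)
  also have "\<dots> = convolve \<Delta> (*) g (convolve \<Delta> (*) f f)"
    using convolve_assoc[OF co fg(2,1,1)] by (simp add: scale)
  also have "\<dots> = \<epsilon>" by (simp add: g_f flip: f_f)
  finally have "f = \<epsilon>" .
  then have "g = \<epsilon>" using f_g unit[OF fg(2)] by simp
  then show ?thesis by (simp add: g_def fun_eq_iff)
qed

text \<open>Convolving the axiom \<open>mop = r * m * rbar\<close> (products being convolutions) by
  \<open>rbar\<close> on the left gives \<open>rbar * mop = m * rbar\<close>, here evaluated at
  \<open>a \<otimes> u\<close>. In this form it enters the Yetter-Drinfeld condition.\<close>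

lemma rbar_quasicommutative:
  assumes "coquasitriangular_star_bialgebra \<Delta> \<epsilon> r rbar"
  shows "tlift (\<lambda>a1 a2. tlift (\<lambda>u1 u2. rbar (a1 \<otimes> u1) *\<^sub>C (u2 * a2)) (\<Delta> u)) (\<Delta> a)
    = tlift (\<lambda>a1 a2. tlift (\<lambda>u1 u2. rbar (a2 \<otimes> u2) *\<^sub>C (a1 * u1)) (\<Delta> u)) (\<Delta> a)"
proof -
  define \<Delta>2 m mop where "\<Delta>2 = tensor_comult \<Delta> \<Delta>" and "m = tlift (\<lambda>a b :: 'a. a * b)"
    and "mop = tlift (\<lambda>a b :: 'a. b * a)"
  have co: "coalgebra \<Delta> \<epsilon>" and r: "clinear r" "clinear rbar"
    and inv: "convolve \<Delta>2 (*) rbar r = tlift (\<lambda>a b. \<epsilon> a * \<epsilon> b)"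
    and mop: "mop = convolve \<Delta>2 (*\<^sub>C) r (convolve \<Delta>2 (\<lambda>x c. c *\<^sub>C x) m rbar)"
    using assms
    by (auto simp: coquasitriangular_star_bialgebra_def Let_def star_bialgebra_def
        star_bialgebra_wrt_def \<Delta>2_def m_def mop_def)
  have \<Delta>: "clinear \<Delta>" "clinear \<epsilon>" using co by (auto simp: coalgebra_def)
  note lin' = lin clinear_compose[OF \<Delta>(1)] clinear_compose[OF \<Delta>(2)] clinear_compose[OF r(2)]
  have co2: "coalgebra \<Delta>2 (tlift (\<lambda>a b. \<epsilon> a * \<epsilon> b))"
    unfolding \<Delta>2_def by (rule coalgebra_tensor_comult[OF co co])
  then have \<Delta>2: "clinear \<Delta>2" "clinear (tlift (\<lambda>a b. \<epsilon> a * \<epsilon> b))" by (auto simp: coalgebra_def)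
  have bm: "cbilinear (\<lambda>a b :: 'a. a * b)" "cbilinear (\<lambda>a b :: 'a. b * a)" by (intro lin)+
  have m: "clinear m" "clinear mop" unfolding m_def mop_def by (intro clinear_tlift bm)+
  have lin_m: "clinear h \<Longrightarrow> clinear (\<lambda>x. convolve \<Delta>2 (\<lambda>x c. c *\<^sub>C x) m rbar (h x))"
    for h :: "'x::complex_vector \<Rightarrow> _"
    unfolding convolve_def by (intro lin' clinear_compose[OF \<Delta>2(1)] clinear_compose[OF m(1)])
  have "convolve \<Delta>2 (*\<^sub>C) rbar mop
    = convolve \<Delta>2 (*\<^sub>C) (convolve \<Delta>2 (*) rbar r) (convolve \<Delta>2 (\<lambda>x c. c *\<^sub>C x) m rbar)"
    unfolding mop by (rule convolve_assoc[OF co2 r(2,1) lin_m[OF clinear_ident]])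
  also have "\<dots> = convolve \<Delta>2 (\<lambda>x c. c *\<^sub>C x) m rbar"
    using counit_left[OF co2 \<Delta>2(2) lin_m[OF clinear_ident]]
    by (simp add: inv fun_eq_iff convolve_def[of _ "(*\<^sub>C)"])
  finally have "convolve \<Delta>2 (*\<^sub>C) rbar mop (a \<otimes> u) = convolve \<Delta>2 (\<lambda>x c. c *\<^sub>C x) m rbar (a \<otimes> u)"
    by simp
  then show ?thesis
    unfolding convolve_def \<Delta>2_def
    by (subst (asm) (1 2) tlift_tensor_comult[OF \<Delta>(1,1)],
        (intro lin' clinear_compose[OF m(1)] clinear_compose[OF m(2)])+)
      (simp add: m_def mop_def tlift_tensor[OF bm(1)] tlift_tensor[OF bm(2)])
qed

text \<open>The Yetter-Drinfeld condition for the induced action is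
  \<open>rbar_quasicommutative\<close> with a further leg \<open>v0\<close> tensored on:
  coassociativity of \<open>\<gamma>\<close> turns the repeated coaction into a coproduct of
  \<open>u\<close>, and back again after the exchange.\<close>

lemma coquasitriangular_object:
  assumes r: "coquasitriangular_star_bialgebra \<Delta> \<epsilon> r rbar" and \<gamma>: "is_comodule \<Delta> \<epsilon> \<gamma>"
  defines "act \<equiv> induced_action rbar \<gamma>"
  shows "cbilinear act" and "act 1 v = v"
    and "tlift (\<lambda>a1 a2. tlift (\<lambda>u v0. (a1 * u) \<otimes> act a2 v0) (\<gamma> v)) (\<Delta> a) =
      tlift (\<lambda>a1 a2. tlift (\<lambda>u v0. (u * a2) \<otimes> v0) (\<gamma> (act a1 v))) (\<Delta> a)"
proof -
  have co: "coalgebra \<Delta> \<epsilon>" and rbar: "clinear rbar"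
    using r
    by (auto simp: coquasitriangular_star_bialgebra_def Let_def star_bialgebra_def
        star_bialgebra_wrt_def)
  have \<Delta>: "clinear \<Delta>" "clinear \<gamma>" using co \<gamma> by (auto simp: coalgebra_def is_comodule_def)
  note lin' = lin clinear_compose[OF \<Delta>(1)] clinear_compose[OF \<Delta>(2)] clinear_compose[OF rbar]
  show "cbilinear act" unfolding act_def induced_action_def by (intro lin')
  show "act 1 v = v"
    using \<gamma> by (simp add: act_def induced_action_def rbar_one[OF r] is_comodule_def)
  have coact: "tlift F (\<gamma> (act a v)) = tlift (\<lambda>u v0. rbar (a \<otimes> u) *\<^sub>C tlift F (\<gamma> v0)) (\<gamma> v)"
    if "cbilinear F" for F :: "'a \<Rightarrow> 'b \<Rightarrow> 'a \<otimes> 'b" and a v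
  proof -
    have "clinear (\<lambda>x. tlift F (\<gamma> x))" by (intro lin' that)
    then show ?thesis
      unfolding act_def induced_action_def
      by (subst tlift_linear[where g = "\<lambda>x. tlift F (\<gamma> x)"], assumption, intro lin')
        (simp add: clinear_iff)
  qed
  have "tlift (\<lambda>a1 a2. tlift (\<lambda>u v0. (a1 * u) \<otimes> act a2 v0) (\<gamma> v)) (\<Delta> a)
    = tlift (\<lambda>a1 a2. tlift (\<lambda>u v0. tlift (\<lambda>u' v'. rbar (a2 \<otimes> u') *\<^sub>C ((a1 * u) \<otimes> v')) (\<gamma> v0)) (\<gamma> v)) (\<Delta> a)"
    unfolding act_def induced_action_def
    by (subst tensor_tlift, (intro lin')+) (simp add: tensor_scaleC_right)
  also have "\<dots> = tlift (\<lambda>a1 a2. tlift (\<lambda>u v0. tlift (\<lambda>u1 u2. rbar (a2 \<otimes> u2) *\<^sub>C ((a1 * u1) \<otimes> v0)) (\<Delta> u)) (\<gamma> v)) (\<Delta> a)"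
    by (subst comodule_coassoc[OF \<gamma> \<Delta>(1)], (intro lin')+, rule refl)
  also have "\<dots> = tlift (\<lambda>u v0. tlift (\<lambda>a1 a2. tlift (\<lambda>u1 u2. rbar (a2 \<otimes> u2) *\<^sub>C (a1 * u1)) (\<Delta> u)) (\<Delta> a) \<otimes> v0) (\<gamma> v)"
    by (subst tlift_swap, (intro lin')+)
      (simp add: lin' flip: tlift_tensor_of tensor_scaleC_left)
  also have "\<dots> = tlift (\<lambda>u v0. tlift (\<lambda>a1 a2. tlift (\<lambda>u1 u2. rbar (a1 \<otimes> u1) *\<^sub>C (u2 * a2)) (\<Delta> u)) (\<Delta> a) \<otimes> v0) (\<gamma> v)"
    by (simp only: rbar_quasicommutative[OF r])
  also have "\<dots> = tlift (\<lambda>a1 a2. tlift (\<lambda>u v0. tlift (\<lambda>u1 u2. rbar (a1 \<otimes> u1) *\<^sub>C ((u2 * a2) \<otimes> v0)) (\<Delta> u)) (\<gamma> v)) (\<Delta> a)"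
    by (subst (2) tlift_swap, (intro lin')+)
      (simp add: lin' flip: tlift_tensor_of tensor_scaleC_left)
  also have "\<dots> = tlift (\<lambda>a1 a2. tlift (\<lambda>u v0. tlift (\<lambda>u' v'. rbar (a1 \<otimes> u) *\<^sub>C ((u' * a2) \<otimes> v')) (\<gamma> v0)) (\<gamma> v)) (\<Delta> a)"
    by (subst comodule_coassoc[OF \<gamma> \<Delta>(1)], (intro lin')+, rule refl)
  also have "\<dots> = tlift (\<lambda>a1 a2. tlift (\<lambda>u v0. (u * a2) \<otimes> v0) (\<gamma> (act a1 v))) (\<Delta> a)"
    by (simp add: coact scaleC_tlift lin')
  finally show "tlift (\<lambda>a1 a2. tlift (\<lambda>u v0. (a1 * u) \<otimes> act a2 v0) (\<gamma> v)) (\<Delta> a) =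
      tlift (\<lambda>a1 a2. tlift (\<lambda>u v0. (u * a2) \<otimes> v0) (\<gamma> (act a1 v))) (\<Delta> a)" .
qed

text \<open>The properties shared by both variants of the category: by definition in the Hopf case,
  by the preceding lemmas in the coquasi-triangular case. The case distinction ends here.\<close>

lemma category_object_yetter_drinfeld:
  assumes "category_object \<Delta> \<epsilon> act \<gamma>"
  shows "star_bialgebra \<Delta> \<epsilon>" and "star_comodule \<Delta> \<epsilon> \<gamma>" and "cbilinear act" and "act 1 v = v"
    and "tlift (\<lambda>a1 a2. tlift (\<lambda>u v0. (a1 * u) \<otimes> act a2 v0) (\<gamma> v)) (\<Delta> a) =
      tlift (\<lambda>a1 a2. tlift (\<lambda>u v0. (u * a2) \<otimes> v0) (\<gamma> (act a1 v))) (\<Delta> a)"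
proof -
  consider S where "hopf_star_algebra \<Delta> \<epsilon> S" "hopf_object \<Delta> \<epsilon> S act \<gamma>"
    | r rbar where "coquasitriangular_star_bialgebra \<Delta> \<epsilon> r rbar" "star_comodule \<Delta> \<epsilon> \<gamma>"
      "act = induced_action rbar \<gamma>"
    using assms by (auto simp: category_object_def)
  then have "star_bialgebra \<Delta> \<epsilon> \<and> star_comodule \<Delta> \<epsilon> \<gamma> \<and> cbilinear act \<and> (\<forall>v. act 1 v = v) \<and>
    (\<forall>a v. tlift (\<lambda>a1 a2. tlift (\<lambda>u v0. (a1 * u) \<otimes> act a2 v0) (\<gamma> v)) (\<Delta> a) =
      tlift (\<lambda>a1 a2. tlift (\<lambda>u v0. (u * a2) \<otimes> v0) (\<gamma> (act a1 v))) (\<Delta> a))"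
  proof cases
    case 1
    then show ?thesis
      unfolding hopf_star_algebra_def hopf_object_def is_module_def by blast
  next
    case 2
    then have "is_comodule \<Delta> \<epsilon> \<gamma>" "star_bialgebra \<Delta> \<epsilon>"
      by (simp_all add: star_comodule_def coquasitriangular_star_bialgebra_def Let_def)
    with 2 coquasitriangular_object[OF 2(1) this(1)] show ?thesis by blast
  qed
  then show "star_bialgebra \<Delta> \<epsilon>" "star_comodule \<Delta> \<epsilon> \<gamma>" "cbilinear act" "act 1 v = v"
    "tlift (\<lambda>a1 a2. tlift (\<lambda>u v0. (a1 * u) \<otimes> act a2 v0) (\<gamma> v)) (\<Delta> a) =
      tlift (\<lambda>a1 a2. tlift (\<lambda>u v0. (u * a2) \<otimes> v0) (\<gamma> (act a1 v))) (\<Delta> a)"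
    by blast+
qed


section \<open>Involutions on tensor products\<close>

lemma star_one: "star 1 = (1 :: 'a::star_algebra)"
  by (metis mult_1 mult_1_right star_mult star_star)

lemma biantilinear_star: "biantilinear (\<lambda>(v::'v::star_vector) (w::'w::star_vector). star v \<otimes> star w)"
  by (simp add: biantilinear_def antilinear_def star_add star_scaleC tensor_add_left
      tensor_add_right tensor_scaleC_left tensor_scaleC_right)

lemma antilinear_star_tensor: "antilinear star_tensor"
  unfolding star_tensor_def by (rule antilinear_tlift_anti[OF biantilinear_star])

lemma star_tensor_add: "star_tensor (x + y) = star_tensor x + star_tensor y"
  by (rule antilinear_star_tensor[unfolded antilinear_def, THEN conjunct1, rule_format])

lemma star_tensor_tensor: "star_tensor (v \<otimes> w) = star v \<otimes> star w"
  unfolding star_tensor_def by (rule tlift_anti_tensor[OF biantilinear_star])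

lemma star_tlift:
  fixes F G :: "'v::star_vector \<Rightarrow> 'w::star_vector \<Rightarrow> 'u::star_vector"
  assumes "cbilinear F" "cbilinear G" "\<And>v w. star (F v w) = G (star v) (star w)"
  shows "star (tlift F x) = tlift G (star_tensor x)"
proof -
  have "(\<lambda>x. star (tlift F x)) = (\<lambda>x. tlift G (star_tensor x))"
    by (rule tensor_map_unique)
      (use clinear_tlift[OF assms(1)] clinear_tlift[OF assms(2)]
        in \<open>simp_all add: star_tensor_add antilinear_def clinear_iff star_add star_tensor_tensor tlift_tensor assms\<close>)
  then show ?thesis by (rule fun_cong)
qed

lemma tlift_anti_star:
  fixes G :: "'v::star_vector \<Rightarrow> 'w::star_vector \<Rightarrow> 'u::complex_vector"
  assumes "cbilinear G"
  shows "tlift_anti (\<lambda>v w. G (star v) (star w)) x = tlift G (star_tensor x)"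
proof -
  have b: "biantilinear (\<lambda>v w. G (star v) (star w))"
    using assms by (simp add: biantilinear_def antilinear_def cbilinear_def clinear_iff star_add star_scaleC)
  have "tlift_anti (\<lambda>v w. G (star v) (star w)) = (\<lambda>x. tlift G (star_tensor x))"
    by (rule tensor_map_unique)
      (use antilinear_tlift_anti[OF b] clinear_tlift[OF assms]
        in \<open>simp_all add: star_tensor_add antilinear_def clinear_iff star_tensor_tensor tlift_tensor tlift_anti_tensor[OF b] assms\<close>)
  then show ?thesis by (rule fun_cong)
qed

lemma flip_tensor: "flip (v \<otimes> w) = w \<otimes> v"
  unfolding flip_def by (subst tlift_tensor) (intro lin refl)+

text \<open>For the flip, \<open>braided_star\<close> is thus the ordinary involution
  \<open>star_tensor\<close>; this gives \<open>\<Delta>A_star\<close> below.\<close>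

lemma flip_star_tensor_flip: "flip (star_tensor (flip x)) = star_tensor x"
proof -
  have flip: "flip (x + y) = flip x + flip y" for x y :: "'x::complex_vector \<otimes> 'y::complex_vector"
  proof -
    have "clinear (flip :: 'x \<otimes> 'y \<Rightarrow> _)" unfolding flip_def by (intro lin)
    then show ?thesis by (simp add: clinear_iff)
  qed
  have "(\<lambda>x. flip (star_tensor (flip x))) = star_tensor"
    by (rule tensor_map_unique)
      (simp_all add: flip star_tensor_add flip_tensor star_tensor_tensor)
  then show ?thesis by (rule fun_cong)
qed

text \<open>Equational form of the hypotheses on both bialgebras, common to the Hopf and the
  coquasi-triangular case. \<open>\<gamma>_mult\<close>, \<open>\<gamma>_one\<close>,
  \<open>act_unit\<close>, \<open>\<Delta>B_coaction\<close> and \<open>\<epsilon>B_coaction\<close>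
  come from the product, unit, coproduct and counit being morphisms.\<close>

locale braided_algebra =
  fixes \<Delta>A :: "'a::star_algebra \<Rightarrow> 'a \<otimes> 'a" and \<epsilon>A :: "'a \<Rightarrow> complex"
    and act :: "'a \<Rightarrow> 'b::star_algebra \<Rightarrow> 'b" and \<gamma> :: "'b \<Rightarrow> 'a \<otimes> 'b"
    and \<Delta>B :: "'b \<Rightarrow> 'b \<otimes> 'b" and \<epsilon>B :: "'b \<Rightarrow> complex"
  assumes coA: "coalgebra \<Delta>A \<epsilon>A"
    and \<Delta>A_one: "\<Delta>A 1 = 1 \<otimes> 1"
    and \<epsilon>A_one: "\<epsilon>A 1 = 1"
    and \<Delta>A_star: "\<Delta>A (star a) = star_tensor (\<Delta>A a)"
    and \<epsilon>A_mult: "\<epsilon>A (a * c) = \<epsilon>A a * \<epsilon>A c"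
    and comod: "is_comodule \<Delta>A \<epsilon>A \<gamma>"
    and \<gamma>_star: "\<gamma> (star b) = star_tensor (\<gamma> b)"
    and \<gamma>_one: "\<gamma> 1 = 1 \<otimes> 1"
    and \<gamma>_mult: "\<gamma> (b * d) = tlift (\<lambda>u v. tlift (\<lambda>u' v'. (u * u') \<otimes> (v * v')) (\<gamma> d)) (\<gamma> b)"
    and act_bilinear: "cbilinear act"
    and act_one: "act 1 b = b"
    and act_unit: "act a 1 = \<epsilon>A a *\<^sub>C 1"
    and yetter_drinfeld: "tlift (\<lambda>a1 a2. tlift (\<lambda>u v. (a1 * u) \<otimes> act a2 v) (\<gamma> b)) (\<Delta>A a)
      = tlift (\<lambda>a1 a2. tlift (\<lambda>u v. (u * a2) \<otimes> v) (\<gamma> (act a1 b))) (\<Delta>A a)"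
    and \<Delta>B_linear: "clinear \<Delta>B"
    and \<Delta>B_one: "\<Delta>B 1 = 1 \<otimes> 1"
    and \<Delta>B_coaction: "tensor_coact \<gamma> \<gamma> (\<Delta>B b) = tmap id \<Delta>B (\<gamma> b)"
    and \<epsilon>B_linear: "clinear \<epsilon>B"
    and \<epsilon>B_one: "\<epsilon>B 1 = 1"
    and \<epsilon>B_coaction: "tmap id \<epsilon>B (\<gamma> b) = 1 \<otimes> \<epsilon>B b"
begin

lemma \<Delta>A_linear: "clinear \<Delta>A" and \<epsilon>A_linear: "clinear \<epsilon>A" and \<gamma>_linear: "clinear \<gamma>"
  using coA comod by (auto simp: coalgebra_def is_comodule_def)

lemmas lin_maps = lin clinear_compose[OF \<Delta>A_linear] clinear_compose[OF \<epsilon>A_linear] clinear_compose[OF \<gamma>_linear]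
  cbilinear_compose_left[OF act_bilinear] cbilinear_compose_right[OF act_bilinear]
  clinear_compose[OF \<Delta>B_linear] clinear_compose[OF \<epsilon>B_linear]

end

lemma braided_star_bialgebra_imp:
  assumes "braided_star_bialgebra \<Delta>A \<epsilon>A act \<gamma> \<Delta>B \<epsilon>B"
  shows "braided_algebra \<Delta>A \<epsilon>A act \<gamma> \<Delta>B \<epsilon>B"
proof -
  have obj: "category_object \<Delta>A \<epsilon>A act \<gamma>"
    and mor: "morphism (tensor_act \<Delta>A act act) (tensor_coact \<gamma> \<gamma>) act \<gamma> (tlift (\<lambda>b c. b * c))"
      "morphism (unit_act \<epsilon>A) unit_coact act \<gamma> (\<lambda>z. z *\<^sub>C 1)"
      "morphism act \<gamma> (tensor_act \<Delta>A act act) (tensor_coact \<gamma> \<gamma>) \<Delta>B"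
      "morphism act \<gamma> (unit_act \<epsilon>A) unit_coact \<epsilon>B"
    and bi: "star_bialgebra_wrt (braiding \<gamma> act) \<Delta>B \<epsilon>B"
    using assms unfolding braided_star_bialgebra_def by blast+
  note yd = category_object_yetter_drinfeld[OF obj]
  have \<gamma>: "clinear \<gamma>" using yd(2) by (simp add: star_comodule_def is_comodule_def)
  note lin' = lin clinear_compose[OF \<gamma>]
  have b: "cbilinear (\<lambda>(b::'b) c. b * c)" by (intro lin)
  have b2: "cbilinear (\<lambda>v w. tlift (\<lambda>a v0. tlift (\<lambda>b w0. (a * b) \<otimes> (v0 \<otimes> w0)) (\<gamma> w)) (\<gamma> v))"
    by (intro lin')
  show ?thesis
  proof (rule braided_algebra.intro)
    fix b d :: 'b
    have "\<gamma> (b * d) = \<gamma> (tlift (\<lambda>b c. b * c) (b \<otimes> d))"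
      by (simp add: tlift_tensor[OF b])
    also have "\<dots> = tmap id (tlift (\<lambda>b c. b * c)) (tensor_coact \<gamma> \<gamma> (b \<otimes> d))"
      using mor(1) by (simp add: morphism_def)
    also have "\<dots> = tlift (\<lambda>u v. tlift (\<lambda>u' v'. (u * u') \<otimes> (v * v')) (\<gamma> d)) (\<gamma> b)"
      unfolding tensor_coact_def tlift_tensor[OF b2] tmap_def id_def
      by (subst tlift_tlift, (intro lin')+, subst tlift_tlift, (intro lin')+,
          subst tlift_tensor, (intro lin')+) (simp only: tlift_tensor[OF b])
    finally show "\<gamma> (b * d) = tlift (\<lambda>u v. tlift (\<lambda>u' v'. (u * u') \<otimes> (v * v')) (\<gamma> d)) (\<gamma> b)" .
  next
    fix a
    have "\<forall>a. act a (1 *\<^sub>C 1) = unit_act \<epsilon>A a 1 *\<^sub>C 1"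
      using mor(2) by (simp add: morphism_def)
    then show "act a 1 = \<epsilon>A a *\<^sub>C 1" by (simp add: unit_act_def scaleC_one)
  next
    have "\<forall>z. \<gamma> (z *\<^sub>C 1) = tmap id (\<lambda>z. z *\<^sub>C 1) (unit_coact z)"
      using mor(2) by (simp add: morphism_def)
    from this[rule_format, of 1] show "\<gamma> 1 = 1 \<otimes> 1"
      by (simp add: unit_coact_def tmap_tensor scaleC_one lin id_def)
  qed (use yd mor(3,4) bi in \<open>auto simp: star_bialgebra_def star_bialgebra_wrt_def star_comodule_def
        morphism_def unit_coact_def coalgebra_def braided_star_def flip_star_tensor_flip\<close>)
qed

section \<open>The process on the braided bialgebra\<close>

definition valid_interval :: "real \<Rightarrow> real \<Rightarrow> real \<Rightarrow> bool"
  where "valid_interval T s t \<longleftrightarrow> 0 \<le> s \<and> s \<le> t \<and> t \<le> T"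

text \<open>The algebraic relations between the restrictions of a process on the symmetrization to
  its two tensor factors; no state enters. \<open>I\<close> is closed under convolution by itself,
  whereas \<open>K_convolve\<close> has an \<open>I\<close> between its \<open>K\<close> factors,
  produced by the coaction in the coproduct of the symmetrization. \<open>IK\<close> is the smash
  product relation, and \<open>commute\<close> is what independence with respect to the flip
  gives.\<close>

locale split_process = braided_algebra \<Delta>A \<epsilon>A act \<gamma> \<Delta>B \<epsilon>B
  for \<Delta>A :: "'a::star_algebra \<Rightarrow> 'a \<otimes> 'a" and \<epsilon>A :: "'a \<Rightarrow> complex"
    and act :: "'a \<Rightarrow> 'b::star_algebra \<Rightarrow> 'b" and \<gamma> :: "'b \<Rightarrow> 'a \<otimes> 'b"
    and \<Delta>B :: "'b \<Rightarrow> 'b \<otimes> 'b" and \<epsilon>B :: "'b \<Rightarrow> complex" +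
  fixes T :: real and I :: "real \<Rightarrow> real \<Rightarrow> 'a \<Rightarrow> 'h::star_algebra" and K :: "real \<Rightarrow> real \<Rightarrow> 'b \<Rightarrow> 'h"
  assumes I_linear: "valid_interval T s t \<Longrightarrow> clinear (I s t)"
    and I_one: "valid_interval T s t \<Longrightarrow> I s t 1 = 1"
    and I_mult: "valid_interval T s t \<Longrightarrow> I s t (a * c) = I s t a * I s t c"
    and I_star: "valid_interval T s t \<Longrightarrow> I s t (star a) = star (I s t a)"
    and I_convolve: "\<lbrakk>valid_interval T r s; valid_interval T s t\<rbrakk> \<Longrightarrow>
      I r t a = tlift (\<lambda>a1 a2. I r s a1 * I s t a2) (\<Delta>A a)"
    and I_refl: "valid_interval T t t \<Longrightarrow> I t t a = \<epsilon>A a *\<^sub>C 1"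
    and K_linear: "valid_interval T s t \<Longrightarrow> clinear (K s t)"
    and K_one: "valid_interval T s t \<Longrightarrow> K s t 1 = 1"
    and K_mult: "valid_interval T s t \<Longrightarrow> K s t (b * d) = K s t b * K s t d"
    and K_star: "valid_interval T s t \<Longrightarrow> K s t (star b) = star (K s t b)"
    and K_convolve: "\<lbrakk>valid_interval T r s; valid_interval T s t\<rbrakk> \<Longrightarrow>
      K r t b = tlift (\<lambda>b1 b2. tlift (\<lambda>u v. K r s b1 * I r s u * K s t v) (\<gamma> b2)) (\<Delta>B b)"
    and K_refl: "valid_interval T t t \<Longrightarrow> K t t b = \<epsilon>B b *\<^sub>C 1"
    and IK: "valid_interval T s t \<Longrightarrow>
      I s t a * K s t b = tlift (\<lambda>a1 a2. K s t (act a1 b) * I s t a2) (\<Delta>A a)"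
    and commute:
      "\<lbrakk>valid_interval T s t; valid_interval T s' t'; t \<le> s'\<rbrakk> \<Longrightarrow> I s' t' a * I s t c = I s t c * I s' t' a"
      "\<lbrakk>valid_interval T s t; valid_interval T s' t'; t \<le> s'\<rbrakk> \<Longrightarrow> I s' t' a * K s t b = K s t b * I s' t' a"
      "\<lbrakk>valid_interval T s t; valid_interval T s' t'; t \<le> s'\<rbrakk> \<Longrightarrow> K s' t' b * I s t c = I s t c * K s' t' b"
      "\<lbrakk>valid_interval T s t; valid_interval T s' t'; t \<le> s'\<rbrakk> \<Longrightarrow> K s' t' b * K s t d = K s t d * K s' t' b"
begin

definition hat :: "real \<Rightarrow> real \<Rightarrow> 'b \<Rightarrow> 'h"
  where "hat s t b = tlift (\<lambda>u v. I 0 s u * K s t v) (\<gamma> b)"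

lemma valid_interval_from_0: "valid_interval T s t \<Longrightarrow> valid_interval T 0 s"
  by (simp add: valid_interval_def)

lemmas linI = clinear_compose[OF I_linear]
lemmas linK = clinear_compose[OF K_linear]

lemma hat_linear: "valid_interval T s t \<Longrightarrow> clinear (hat s t)"
  unfolding hat_def by (intro lin_maps linI linK | simp add: valid_interval_from_0)+

lemma hat_one:
  assumes st: "valid_interval T s t"
  shows "hat s t 1 = 1"
proof -
  note lin' = lin_maps linI[OF valid_interval_from_0[OF st]] linK[OF st]
  show ?thesis
    unfolding hat_def \<gamma>_one
    by (subst tlift_tensor, (intro lin')+)
      (simp add: I_one[OF valid_interval_from_0[OF st]] K_one[OF st])
qed

lemma tlift_coaction_mult:
  assumes F: "cbilinear F"
  shows "tlift F (\<gamma> (b * d)) = tlift (\<lambda>u v. tlift (\<lambda>u' v'. F (u * u') (v * v')) (\<gamma> d)) (\<gamma> b)"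
  unfolding \<gamma>_mult
  by (subst tlift_tlift, (intro lin_maps F)+, subst tlift_tlift, (intro lin_maps F)+)
    (simp only: tlift_tensor[OF F])

text \<open>The coaction is multiplicative, and \<open>I 0 s\<close> commutes with
  \<open>K s t\<close> because the intervals meet only at \<open>s\<close>; this sorts the four
  factors.\<close>

lemma hat_mult:
  assumes st: "valid_interval T s t"
  shows "hat s t (b * d) = hat s t b * hat s t d"
proof -
  note 0 = valid_interval_from_0[OF st]
  note lin' = lin_maps linI[OF 0] linK[OF st]
  have "hat s t (b * d) = tlift (\<lambda>u v. tlift (\<lambda>u' v'.
      (I 0 s u * K s t v) * (I 0 s u' * K s t v')) (\<gamma> d)) (\<gamma> b)"
    unfolding hat_def
    by (subst tlift_coaction_mult, (intro lin')+)
      (simp add: I_mult[OF 0] K_mult[OF st] mult.assoc,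
        simp add: commute(3)[OF 0 st] mult.assoc flip: mult.assoc[of "K s t _"])
  also have "\<dots> = hat s t b * hat s t d"
    unfolding hat_def
    by (subst tlift_times, (intro lin')+, subst times_tlift, (intro lin')+, rule refl)
  finally show ?thesis .
qed

text \<open>The involution reverses \<open>I\<close> and \<open>K\<close>, but these commute, so the
  same integrand serves on both sides.\<close>

lemma hat_star:
  assumes st: "valid_interval T s t"
  shows "hat s t (star b) = star (hat s t b)"
proof -
  note 0 = valid_interval_from_0[OF st]
  note lin' = lin_maps linI[OF 0] linK[OF st]
  show ?thesis
    unfolding hat_def \<gamma>_star
    by (rule star_tlift[symmetric], (intro lin')+)
      (simp add: star_mult commute(3)[OF 0 st] flip: I_star[OF 0] K_star[OF st])
qed

text \<open>\<open>K t t\<close> is the counit, a comodule map, so the coaction collapses to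
  \<open>1 \<otimes> \<epsilon>B b\<close> and \<open>I 0 t\<close> is evaluated at 1.\<close>

lemma hat_refl:
  assumes t: "valid_interval T t t"
  shows "hat t t b = \<epsilon>B b *\<^sub>C 1"
proof -
  note 0 = valid_interval_from_0[OF t]
  note lin' = lin_maps linI[OF 0]
  have "hat t t b = tlift (\<lambda>u z. z *\<^sub>C I 0 t u) (tmap id \<epsilon>B (\<gamma> b))"
    unfolding hat_def id_def
    by (subst tlift_tmap, (intro lin' \<epsilon>B_linear)+) (simp add: K_refl[OF t] scaleC_mult_right)
  then show ?thesis
    unfolding \<epsilon>B_coaction by (subst (asm) tlift_tensor, (intro lin')+) (simp add: I_one[OF 0])
qed

text \<open>Splitting \<open>I 0 s\<close> at \<open>r\<close> and moving the part up to
  \<open>r\<close> left past \<open>K r s\<close> gives \<open>I 0 r (p * p')\<close> times the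
  integrand of \<open>K_convolve\<close>. The legs \<open>p * p'\<close> and
  \<open>q \<otimes> q'\<close> form the codiagonal coaction of \<open>\<Delta>B b\<close>, and
  \<open>\<Delta>B\<close> is a comodule map; what remains is the sum defining
  \<open>hat r t b\<close>.\<close>

lemma hat_convolve:
  assumes rs: "valid_interval T r s" and st: "valid_interval T s t"
  shows "tlift (\<lambda>b1 b2. hat r s b1 * hat s t b2) (\<Delta>B b) = hat r t b"
proof -
  note 0 = valid_interval_from_0[OF rs] valid_interval_from_0[OF st]
  have rt: "valid_interval T r t" using rs st by (simp add: valid_interval_def)
  note lin' = lin_maps linI[OF 0(1)] linI[OF 0(2)] linI[OF rs] linK[OF rs] linK[OF st] linK[OF rt]
  \<comment> \<open>The inner sum of \<open>K_convolve\<close>, as a function of the two legs of the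
    coproduct.\<close>
  define G where "G q w = tlift (\<lambda>u v. K r s q * I r s u * K s t v) (\<gamma> w)" for q w
  have "cbilinear G" unfolding G_def by (intro lin')
  note linG = lin' cbilinear_compose_left[OF this] cbilinear_compose_right[OF this]
  have hat_st: "hat s t b2 = tlift (\<lambda>p v. tlift (\<lambda>u v. I 0 r p * I r s u * K s t v) (\<gamma> v)) (\<gamma> b2)" for b2
    unfolding hat_def I_convolve[OF 0(1) rs]
    by (subst tlift_times, (intro lin')+, subst comodule_coassoc[OF comod \<Delta>A_linear], (intro lin')+,
        rule refl)
  have "hat r s b1 * hat s t b2 = tlift (\<lambda>p q. tlift (\<lambda>p' q'. I 0 r (p * p') * G q q') (\<gamma> b2)) (\<gamma> b1)"
    for b1 b2
  proof -
    have "hat r s b1 * hat s t b2 = tlift (\<lambda>p q. tlift (\<lambda>p' q'.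
        tlift (\<lambda>u v. I 0 r p * K r s q * (I 0 r p' * I r s u * K s t v)) (\<gamma> q')) (\<gamma> b2)) (\<gamma> b1)"
      unfolding hat_st unfolding hat_def
      by (subst tlift_times, (intro lin')+, subst times_tlift, (intro lin')+,
          subst times_tlift, (intro lin')+, rule refl)
    also have "\<dots> = tlift (\<lambda>p q. tlift (\<lambda>p' q'.
        tlift (\<lambda>u v. I 0 r (p * p') * (K r s q * I r s u * K s t v)) (\<gamma> q')) (\<gamma> b2)) (\<gamma> b1)"
    proof -
      have "I 0 r p * K r s q * (I 0 r p' * I r s u * K s t v)
        = I 0 r (p * p') * (K r s q * I r s u * K s t v)" for p q p' u v
        using commute(3)[OF 0(1) rs order_refl, of q p']
        by (simp add: I_mult[OF 0(1)] mult.assoc) (simp flip: mult.assoc)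
      then show ?thesis by simp
    qed
    also have "\<dots> = tlift (\<lambda>p q. tlift (\<lambda>p' q'. I 0 r (p * p') * G q q') (\<gamma> b2)) (\<gamma> b1)"
      unfolding G_def by (subst times_tlift, (intro lin')+, rule refl)
    finally show ?thesis .
  qed
  then have "tlift (\<lambda>b1 b2. hat r s b1 * hat s t b2) (\<Delta>B b)
    = tlift (\<lambda>b1 b2. tlift (\<lambda>p q. tlift (\<lambda>p' q'. I 0 r (p * p') * G q q') (\<gamma> b2)) (\<gamma> b1)) (\<Delta>B b)"
    by simp
  also have "\<dots> = tlift (\<lambda>p x. tlift (\<lambda>q q'. I 0 r p * G q q') x) (tensor_coact \<gamma> \<gamma> (\<Delta>B b))"
    unfolding tensor_coact_def
    by (subst tlift_tlift, (intro linG)+, subst tlift_tlift, (intro linG)+,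
        subst tlift_tlift, (intro linG)+, subst tlift_tensor, (intro linG)+,
        subst tlift_tensor, (intro linG)+, rule refl)
  also have "\<dots> = tlift (\<lambda>p v. I 0 r p * K r t v) (\<gamma> b)"
    unfolding \<Delta>B_coaction id_def
    by (subst tlift_tmap, (intro linG \<Delta>B_linear)+, subst times_tlift[symmetric], (intro linG)+)
      (simp only: K_convolve[OF rs st] G_def[abs_def])
  finally show ?thesis by (simp only: hat_def)
qed

section \<open>Commutation relations between increments of \<open>hat\<close>\<close>

lemma commute_hat:
  assumes st: "valid_interval T s t" and x: "\<And>u. x * I 0 s u = I 0 s u * x" "\<And>v. x * K s t v = K s t v * x"
  shows "x * hat s t b = hat s t b * x"
proof -
  note 0 = valid_interval_from_0[OF st]
  note lin' = lin_maps linI[OF 0] linK[OF st]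
  have "x * (I 0 s u * K s t v) = I 0 s u * K s t v * x" for u v
    by (metis x mult.assoc)
  then show ?thesis
    unfolding hat_def by (subst times_tlift, (intro lin')+, subst tlift_times, (intro lin')+) simp
qed

text \<open>With \<open>I 0 t\<close> split at \<open>s\<close>, the part over \<open>[0, s]\<close>
  multiplies \<open>u\<close> from the left, and \<open>IK\<close> moves \<open>I s t\<close> past
  \<open>K s t\<close>, acting on \<open>v\<close>. The resulting
  \<open>(a1 * u) \<otimes> act a2 v\<close> is the left side of the Yetter-Drinfeld condition; its
  right side contains the coaction of \<open>act a1 b\<close> and so produces
  \<open>hat s t (act a1 b)\<close>.\<close>

lemma I_hat_adjacent:
  assumes st: "valid_interval T s t"
  shows "I 0 t a * hat s t b = tlift (\<lambda>a1 a2. hat s t (act a1 b) * I 0 t a2) (\<Delta>A a)"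
proof -
  note 0 = valid_interval_from_0[OF st]
  note lin' = lin_maps linI[OF 0] linI[OF st] linK[OF st]
  have "I 0 t a * hat s t b = tlift (\<lambda>a1 a2. tlift (\<lambda>u v. I 0 s a1 * I s t a2 * (I 0 s u * K s t v)) (\<gamma> b)) (\<Delta>A a)"
    unfolding I_convolve[OF 0 st] hat_def
    by (subst tlift_times, (intro lin')+, subst times_tlift, (intro lin')+, rule refl)
  also have "\<dots> = tlift (\<lambda>a1 a2. tlift (\<lambda>u v. I 0 s (a1 * u) * (I s t a2 * K s t v)) (\<gamma> b)) (\<Delta>A a)"
  proof -
    have "I 0 s a1 * I s t a2 * (I 0 s u * K s t v) = I 0 s (a1 * u) * (I s t a2 * K s t v)"
      for a1 a2 u v
      using commute(1)[OF 0 st order_refl, of a2 u]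
      by (simp add: I_mult[OF 0] mult.assoc) (simp flip: mult.assoc)
    then show ?thesis by simp
  qed
  also have "\<dots> = tlift (\<lambda>a1 a2. tlift (\<lambda>u v. tlift (\<lambda>a2 a3. I 0 s (a1 * u) * (K s t (act a2 v) * I s t a3)) (\<Delta>A a2)) (\<gamma> b)) (\<Delta>A a)"
    unfolding IK[OF st] by (subst times_tlift, (intro lin')+, rule refl)
  also have "\<dots> = tlift (\<lambda>a1 a2. tlift (\<lambda>a2 a3. tlift (\<lambda>u v. I 0 s (a1 * u) * (K s t (act a2 v) * I s t a3)) (\<gamma> b)) (\<Delta>A a2)) (\<Delta>A a)"
    by (subst (2) tlift_swap, (intro lin')+, rule refl)
  \<comment> \<open>The three legs of \<open>a\<close> are regrouped so that the first two come from
    one coproduct, as the Yetter-Drinfeld condition requires.\<close>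
  also have "\<dots> = tlift (\<lambda>a1 a3. tlift (\<lambda>a1 a2. tlift (\<lambda>u v. I 0 s (a1 * u) * (K s t (act a2 v) * I s t a3)) (\<gamma> b)) (\<Delta>A a1)) (\<Delta>A a)"
    by (rule coassoc[OF coA \<Delta>A_linear, symmetric]) (intro lin')+
  also have "\<dots> = tlift (\<lambda>a1 a3. tlift (\<lambda>a1 a2. tlift (\<lambda>u v. I 0 s (u * a2) * (K s t v * I s t a3)) (\<gamma> (act a1 b))) (\<Delta>A a1)) (\<Delta>A a)"
  proof -
    have "tlift (\<lambda>a1 a2. tlift (\<lambda>u v. F (a1 * u) (act a2 v)) (\<gamma> b)) (\<Delta>A a)
      = tlift (\<lambda>a1 a2. tlift (\<lambda>u v. F (u * a2) v) (\<gamma> (act a1 b))) (\<Delta>A a)"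
      if F: "cbilinear F" for F :: "'a \<Rightarrow> 'b \<Rightarrow> 'h" and a
    proof -
      have "tlift (\<lambda>a1 a2. tlift (\<lambda>u v. F (a1 * u) (act a2 v)) (\<gamma> b)) (\<Delta>A a)
        = tlift F (tlift (\<lambda>a1 a2. tlift (\<lambda>u v. (a1 * u) \<otimes> act a2 v) (\<gamma> b)) (\<Delta>A a))"
        by (subst tlift_tlift, (intro lin' F)+, subst tlift_tlift, (intro lin' F)+)
          (simp only: tlift_tensor[OF F])
      also have "\<dots> = tlift (\<lambda>a1 a2. tlift (\<lambda>u v. F (u * a2) v) (\<gamma> (act a1 b))) (\<Delta>A a)"
        unfolding yetter_drinfeld
        by (subst tlift_tlift, (intro lin' F)+, subst tlift_tlift, (intro lin' F)+)
          (simp only: tlift_tensor[OF F])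
      finally show ?thesis .
    qed
    \<comment> \<open>The open place is filled by the third leg, which is constant here.\<close>
    from this[of "\<lambda>x y. I 0 s x * (K s t y * I s t _)"] show ?thesis
      by (simp add: lin')
  qed
  also have "\<dots> = tlift (\<lambda>a1 a3. tlift (\<lambda>a1 a2. hat s t (act a1 b) * (I 0 s a2 * I s t a3)) (\<Delta>A a1)) (\<Delta>A a)"
  proof -
    have "I 0 s (u * a2) * (K s t v * I s t a3) = I 0 s u * K s t v * (I 0 s a2 * I s t a3)" for u a2 v a3
      using commute(3)[OF 0 st order_refl, of v a2]
      by (simp add: I_mult[OF 0] mult.assoc) (simp flip: mult.assoc)
    then show ?thesis
      unfolding hat_def by (subst tlift_times, (intro lin')+) simp
  qed
  \<comment> \<open>Regrouping the other way joins the last two legs, which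
    \<open>I_convolve\<close> merges into \<open>I 0 t\<close>.\<close>
  also have "\<dots> = tlift (\<lambda>a1 a2. tlift (\<lambda>a2 a3. hat s t (act a1 b) * (I 0 s a2 * I s t a3)) (\<Delta>A a2)) (\<Delta>A a)"
    by (rule coassoc[OF coA \<Delta>A_linear]) (intro lin' clinear_compose[OF hat_linear[OF st]])+
  also have "\<dots> = tlift (\<lambda>a1 a2. hat s t (act a1 b) * I 0 t a2) (\<Delta>A a)"
    unfolding I_convolve[OF 0 st] by (subst times_tlift, (intro lin')+, rule refl)
  finally show ?thesis .
qed

text \<open>\<open>I 0 w\<close> splits at \<open>t\<close>; the later part \<open>I t w\<close>
  commutes with \<open>hat s t\<close>, and the adjacent case applies to the earlier part.\<close>

lemma I_hat:
  assumes st: "valid_interval T s t" and tw: "valid_interval T t w"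
  shows "I 0 w a * hat s t b = tlift (\<lambda>a1 a2. hat s t (act a1 b) * I 0 w a2) (\<Delta>A a)"
proof -
  have 0: "valid_interval T 0 s" "valid_interval T 0 t" "s \<le> t"
    using st by (auto simp: valid_interval_def)
  note lin' = lin_maps linI[OF 0(2)] linI[OF tw] clinear_compose[OF hat_linear[OF st]]
  have comm: "I t w a * hat s t b = hat s t b * I t w a" for a
    by (rule commute_hat[OF st]) (simp_all add: commute(1)[OF 0(1) tw 0(3)] commute(2)[OF st tw])
  have "I 0 w a * hat s t b = tlift (\<lambda>a1 a2. I 0 t a1 * hat s t b * I t w a2) (\<Delta>A a)"
    unfolding I_convolve[OF 0(2) tw]
    by (subst tlift_times, (intro lin')+) (simp add: comm mult.assoc)
  also have "\<dots> = tlift (\<lambda>a1 a3. tlift (\<lambda>a1 a2. hat s t (act a1 b) * (I 0 t a2 * I t w a3)) (\<Delta>A a1)) (\<Delta>A a)"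
    unfolding I_hat_adjacent[OF st] by (subst tlift_times, (intro lin')+) (simp add: mult.assoc)
  also have "\<dots> = tlift (\<lambda>a1 a2. tlift (\<lambda>a2 a3. hat s t (act a1 b) * (I 0 t a2 * I t w a3)) (\<Delta>A a2)) (\<Delta>A a)"
    by (rule coassoc[OF coA \<Delta>A_linear]) (intro lin')+
  also have "\<dots> = tlift (\<lambda>a1 a2. hat s t (act a1 b) * I 0 w a2) (\<Delta>A a)"
    unfolding I_convolve[OF 0(2) tw] by (subst times_tlift, (intro lin')+, rule refl)
  finally show ?thesis .
qed

text \<open>The factor \<open>K s' t'\<close> commutes with \<open>hat s t\<close>, and
  \<open>I_hat\<close> moves \<open>I 0 s'\<close> across it. By coassociativity of
  \<open>\<gamma>\<close> one leg of \<open>b\<close> then acts on \<open>c\<close> while the others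
  form \<open>hat s' t'\<close> again, which is the braiding.\<close>

lemma hat_braided_commute:
  assumes st: "valid_interval T s t" and st': "valid_interval T s' t'" and "t \<le> s'"
  shows "tlift (\<lambda>b c. hat s' t' b * hat s t c) x = tlift (\<lambda>b c. hat s t b * hat s' t' c) (braiding \<gamma> act x)"
proof -
  have 0: "valid_interval T 0 s" "valid_interval T 0 s'" "s \<le> s'" "valid_interval T t s'"
    using assms by (auto simp: valid_interval_def)
  note lin' = lin_maps linI[OF 0(2)] linK[OF st'] clinear_compose[OF hat_linear[OF st]]
    clinear_compose[OF hat_linear[OF st']]
  have comm: "K s' t' v * hat s t c = hat s t c * K s' t' v" for v c
    by (rule commute_hat[OF st]) (simp_all add: commute(3)[OF 0(1) st' 0(3)] commute(4)[OF st st' \<open>t \<le> s'\<close>])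
  have pure: "hat s' t' b * hat s t c = tlift (\<lambda>u v. hat s t (act u c) * hat s' t' v) (\<gamma> b)" for b c
  proof -
    have "hat s' t' b * hat s t c = tlift (\<lambda>u v. I 0 s' u * hat s t c * K s' t' v) (\<gamma> b)"
      unfolding hat_def[of s' t']
      by (subst tlift_times, (intro lin')+) (simp add: comm mult.assoc)
    also have "\<dots> = tlift (\<lambda>u v. tlift (\<lambda>u u'. hat s t (act u c) * (I 0 s' u' * K s' t' v)) (\<Delta>A u)) (\<gamma> b)"
      unfolding I_hat[OF st 0(4)] by (subst tlift_times, (intro lin')+) (simp add: mult.assoc)
    also have "\<dots> = tlift (\<lambda>u v. tlift (\<lambda>u' v. hat s t (act u c) * (I 0 s' u' * K s' t' v)) (\<gamma> v)) (\<gamma> b)"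
      by (rule comodule_coassoc[OF comod \<Delta>A_linear]) (intro lin')+
    also have "\<dots> = tlift (\<lambda>u v. hat s t (act u c) * hat s' t' v) (\<gamma> b)"
      unfolding hat_def[of s' t'] by (subst times_tlift, (intro lin')+, rule refl)
    finally show ?thesis .
  qed
  show ?thesis
  proof (rule tensor_ext[where x = x])
    fix b c
    have b: "cbilinear (\<lambda>b c. hat s t b * hat s' t' c)"
      "cbilinear (\<lambda>b c. tlift (\<lambda>u v. act u c \<otimes> v) (\<gamma> b))"
      "cbilinear (\<lambda>b c. hat s' t' b * hat s t c)"
      by (intro lin')+
    have "tlift (\<lambda>b c. hat s t b * hat s' t' c) (braiding \<gamma> act (b \<otimes> c))
      = tlift (\<lambda>u v. hat s t (act u c) * hat s' t' v) (\<gamma> b)"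
      unfolding braiding_def tlift_tensor[OF b(2)]
      by (subst tlift_tlift, (intro lin')+) (simp only: tlift_tensor[OF b(1)])
    then show "tlift (\<lambda>b c. hat s' t' b * hat s t c) (b \<otimes> c)
      = tlift (\<lambda>b c. hat s t b * hat s' t' c) (braiding \<gamma> act (b \<otimes> c))"
      unfolding tlift_tensor[OF b(3)] by (simp only: pure)
  qed (unfold braiding_def, (intro lin')+)
qed

end


section \<open>Ordered products over a grid\<close>

text \<open>Pairs of corresponding elements in the linear spans of the products \<open>J 0 b\<^sub>0 \<cdots> J (n - 1) b\<^sub>n\<^sub>-\<^sub>1\<close>
  and \<open>J' 0 b\<^sub>0 \<cdots> J' (n - 1) b\<^sub>n\<^sub>-\<^sub>1\<close>.\<close>

inductive ordered_pair ::
  "(nat \<Rightarrow> 'd \<Rightarrow> 'e::star_algebra) \<Rightarrow> (nat \<Rightarrow> 'd \<Rightarrow> 'f::star_algebra) \<Rightarrow> nat \<Rightarrow> 'e \<Rightarrow> 'f \<Rightarrow> bool"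
  for J J'
  where
    const: "ordered_pair J J' 0 (c *\<^sub>C 1) (c *\<^sub>C 1)"
  | step: "ordered_pair J J' n x y \<Longrightarrow> ordered_pair J J' (Suc n) (x * J n b) (y * J' n b)"
  | add: "ordered_pair J J' n x y \<Longrightarrow> ordered_pair J J' n x' y' \<Longrightarrow> ordered_pair J J' n (x + x') (y + y')"

lemma ordered_pair_scaleC:
  "ordered_pair J J' n x y \<Longrightarrow> ordered_pair J J' n (c *\<^sub>C x) (c *\<^sub>C y)"
proof (induction rule: ordered_pair.induct)
  case (step n x y b)
  then show ?case using ordered_pair.step[of J J' n "c *\<^sub>C x" "c *\<^sub>C y" b] by (simp add: scaleC_mult_left)
qed (auto simp: scaleC_scaleC scaleC_add_right intro: ordered_pair.intros)

lemma ordered_pair_zero: "ordered_pair J J' n 0 0"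
proof (induction n)
  case 0
  show ?case using ordered_pair.const[of J J' 0] by simp
next
  case (Suc n)
  show ?case using ordered_pair.step[OF Suc, of undefined] by simp
qed

text \<open>Both sums run over the same tensor. Hence a relation that two processes share, such as
  convolution or braiding, leads from corresponding elements to corresponding elements.\<close>

lemma ordered_pair_tlift:
  assumes "cbilinear F" "cbilinear F'" "\<And>b c. ordered_pair J J' n (F b c) (F' b c)"
  shows "ordered_pair J J' n (tlift F z) (tlift F' z)"
proof (induction z rule: tensor_induct)
  case zero
  then show ?case
    by (simp add: clinear_zero[OF clinear_tlift] assms ordered_pair_zero)
next
  case (add z b c)
  then show ?case
    using clinear_tlift[OF assms(1)] clinear_tlift[OF assms(2)] assms(3)
    by (simp add: clinear_iff tlift_tensor assms(1,2) ordered_pair.add)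
qed

lemma ordered_pair_moment:
  assumes \<Phi>: "clinear \<Phi>" "clinear \<Phi>'"
    and moments: "\<And>b n. n \<le> m \<Longrightarrow> \<Phi> (prod_list (map (\<lambda>i. J i (b i)) [0..<n]))
      = \<Phi>' (prod_list (map (\<lambda>i. J' i (b i)) [0..<n]))"
  shows "ordered_pair J J' n x y \<Longrightarrow> n \<le> m \<Longrightarrow> (\<Phi> x :: complex) = \<Phi>' y"
proof -
  \<comment> \<open>Generalized to a product with a tail of further factors: each
    \<open>step\<close> of the derivation hands its last factor over to the tail, until only a
    scalar is left and \<open>moments\<close> applies.\<close>
  have "\<Phi> (x * prod_list (map (\<lambda>i. J i (b i)) [n..<k])) = \<Phi>' (y * prod_list (map (\<lambda>i. J' i (b i)) [n..<k]))"
    if "ordered_pair J J' n x y" "n \<le> k" "k \<le> m" for x y n k b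
    using that
  proof (induction arbitrary: b rule: ordered_pair.induct)
    case (const c)
    then show ?case using moments[OF const(2)] \<Phi> by (simp add: scaleC_mult_left clinear_iff)
  next
    case (step n x y c)
    \<comment> \<open>The argument \<open>c\<close> of the released factor is stored at position
      \<open>n\<close> of \<open>b\<close>; later positions keep their values.\<close>
    have tails: "map (\<lambda>i. J i ((b(n := c)) i)) [n..<k] = J n c # map (\<lambda>i. J i (b i)) [Suc n..<k]"
      "map (\<lambda>i. J' i ((b(n := c)) i)) [n..<k] = J' n c # map (\<lambda>i. J' i (b i)) [Suc n..<k]"
      using step(3) by (simp_all add: upt_conv_Cons)
    show ?case
      using step(2)[of "b(n := c)", unfolded tails] step(3,4) by (simp add: mult.assoc)
  next
    case (add n x y x' y')
    then show ?case using \<Phi> by (simp add: distrib_right clinear_iff)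
  qed
  from this[of n x y n undefined] show "ordered_pair J J' n x y \<Longrightarrow> n \<le> m \<Longrightarrow> \<Phi> x = \<Phi>' y" by simp
qed

text \<open>The part of \<open>levy_process\<close> that involves neither state nor involution. It
  suffices for bringing products into increasing time order.\<close>

definition braided_increments ::
  "('d::complex_vector) bialgebra_structure \<Rightarrow> real \<Rightarrow> (real \<Rightarrow> real \<Rightarrow> 'd \<Rightarrow> 'e::star_algebra) \<Rightarrow> bool"
  where "braided_increments D T j \<longleftrightarrow>
    (\<forall>s t. valid_interval T s t \<longrightarrow> clinear (j s t) \<and> j s t (unit_of D) = 1 \<and>
       (\<forall>x y. j s t (mult_of D x y) = j s t x * j s t y)) \<and>
    (\<forall>r s t. valid_interval T r s \<and> valid_interval T s t \<longrightarrow>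
       convolve (comult_of D) (*) (j r s) (j s t) = j r t) \<and>
    (\<forall>t. valid_interval T t t \<longrightarrow> j t t = (\<lambda>b. counit_of D b *\<^sub>C 1)) \<and>
    (\<forall>s t s' t' x. valid_interval T s t \<and> valid_interval T s' t' \<and> t \<le> s' \<longrightarrow>
       tlift (\<lambda>b c. j s' t' b * j s t c) x = tlift (\<lambda>b c. j s t b * j s' t' c) (braiding_of D x))"

text \<open>Repeated points are allowed, and the last point may lie below \<open>T\<close>. The
  start at 0 makes \<open>I 0 (\<tau> 0)\<close> scalar in \<open>hat_grid_moment\<close>.\<close>

definition grid :: "real \<Rightarrow> nat \<Rightarrow> (nat \<Rightarrow> real) \<Rightarrow> bool"
  where "grid T n \<tau> \<longleftrightarrow> \<tau> 0 = 0 \<and> (\<forall>i<n. \<tau> i \<le> \<tau> (Suc i)) \<and> \<tau> n \<le> T"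

lemma grid_mono:
  assumes "grid T n \<tau>" "p \<le> q" "q \<le> n"
  shows "\<tau> p \<le> \<tau> q"
  using assms(2,3)
proof (induction q rule: dec_induct)
  case (step q)
  have "\<tau> q \<le> \<tau> (Suc q)" using assms(1) step.prems by (simp add: grid_def)
  with step show ?case by simp
qed simp

lemma grid_valid_interval: "\<lbrakk>grid T n \<tau>; p \<le> q; q \<le> n\<rbrakk> \<Longrightarrow> valid_interval T (\<tau> p) (\<tau> q)"
  using grid_mono[of T n \<tau> 0 p] grid_mono[of T n \<tau> p q] grid_mono[of T n \<tau> q n]
  by (simp add: valid_interval_def grid_def)

lemma grid_le: "\<lbrakk>grid T n \<tau>; k \<le> n\<rbrakk> \<Longrightarrow> grid T k \<tau>"
  using grid_mono[of T n \<tau> k n] by (auto simp: grid_def)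

text \<open>An increment over the last interval is absorbed by multiplicativity. Any other one is
  moved left past the last factor by the braiding, and the induction hypothesis applies to the
  shorter product. Both processes use the same value of \<open>braiding_of D\<close>, which
  preserves the correspondence.\<close>

lemma ordered_pair_times_increment:
  assumes j: "braided_increments D T j" and j': "braided_increments D T j'" and \<tau>: "grid T m \<tau>"
  defines "R \<equiv> ordered_pair (\<lambda>i. j (\<tau> i) (\<tau> (Suc i))) (\<lambda>i. j' (\<tau> i) (\<tau> (Suc i)))"
  shows "R n x y \<Longrightarrow> n \<le> m \<Longrightarrow> k < n \<Longrightarrow>
    R n (x * j (\<tau> k) (\<tau> (Suc k)) b) (y * j' (\<tau> k) (\<tau> (Suc k)) b)"
  unfolding R_def
proof (induction arbitrary: b rule: ordered_pair.induct)
  case (step n x y c)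
  have v: "valid_interval T (\<tau> i) (\<tau> (Suc i))" if "i < m" for i
    using grid_valid_interval[OF \<tau>, of i "Suc i"] that by simp
  note vn = v[of n] v[of k]
  have hom: "h (\<tau> n) (\<tau> (Suc n)) (mult_of D c b) = h (\<tau> n) (\<tau> (Suc n)) c * h (\<tau> n) (\<tau> (Suc n)) b"
    if "braided_increments D T h" for h :: "real \<Rightarrow> real \<Rightarrow> 'a \<Rightarrow> 'x::star_algebra"
    using that vn step.prems by (simp add: braided_increments_def)
  show ?case
  proof (cases "k = n")
    case True
    then show ?thesis
      using ordered_pair.step[OF step.hyps, of "mult_of D c b"]
      by (simp add: hom[OF j] hom[OF j'] mult.assoc)
  next
    case False
    with step.prems have k: "k < n" "Suc k \<le> n" by auto
    \<comment> \<open>The braiding changes the argument of the moved factor; this is why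
      \<open>b\<close> is arbitrary in the induction.\<close>
    have swap: "x * h (\<tau> n) (\<tau> (Suc n)) c * h (\<tau> k) (\<tau> (Suc k)) b
      = tlift (\<lambda>b c. x * h (\<tau> k) (\<tau> (Suc k)) b * h (\<tau> n) (\<tau> (Suc n)) c) (braiding_of D (c \<otimes> b))"
      and bil: "cbilinear (\<lambda>b c. x * h (\<tau> k) (\<tau> (Suc k)) b * h (\<tau> n) (\<tau> (Suc n)) c)"
      if h: "braided_increments D T h" for h :: "real \<Rightarrow> real \<Rightarrow> 'a \<Rightarrow> 'x::star_algebra" and x
    proof -
      have l: "clinear (h (\<tau> n) (\<tau> (Suc n)))" "clinear (h (\<tau> k) (\<tau> (Suc k)))"
        using h vn step.prems by (auto simp: braided_increments_def)
      note lin' = lin clinear_compose[OF l(1)] clinear_compose[OF l(2)]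
      show "cbilinear (\<lambda>b c. x * h (\<tau> k) (\<tau> (Suc k)) b * h (\<tau> n) (\<tau> (Suc n)) c)"
        by (intro lin')
      have b: "cbilinear (\<lambda>b c. h (\<tau> n) (\<tau> (Suc n)) b * h (\<tau> k) (\<tau> (Suc k)) c)"
        by (intro lin')
      have "x * h (\<tau> n) (\<tau> (Suc n)) c * h (\<tau> k) (\<tau> (Suc k)) b
        = x * tlift (\<lambda>b c. h (\<tau> n) (\<tau> (Suc n)) b * h (\<tau> k) (\<tau> (Suc k)) c) (c \<otimes> b)"
        by (simp only: tlift_tensor[OF b] mult.assoc)
      also have "\<dots> = x * tlift (\<lambda>b c. h (\<tau> k) (\<tau> (Suc k)) b * h (\<tau> n) (\<tau> (Suc n)) c) (braiding_of D (c \<otimes> b))"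
        using h vn step.prems k grid_mono[OF \<tau> k(2)] by (simp add: braided_increments_def)
      also have "\<dots> = tlift (\<lambda>b c. x * h (\<tau> k) (\<tau> (Suc k)) b * h (\<tau> n) (\<tau> (Suc n)) c) (braiding_of D (c \<otimes> b))"
        by (subst times_tlift, (intro lin')+) (simp only: mult.assoc)
      finally show "x * h (\<tau> n) (\<tau> (Suc n)) c * h (\<tau> k) (\<tau> (Suc k)) b
        = tlift (\<lambda>b c. x * h (\<tau> k) (\<tau> (Suc k)) b * h (\<tau> n) (\<tau> (Suc n)) c) (braiding_of D (c \<otimes> b))" .
    qed
    show ?thesis
      unfolding swap[OF j] swap[OF j']
      by (rule ordered_pair_tlift[OF bil[OF j] bil[OF j']])
        (rule ordered_pair.step[where J = "\<lambda>i. j (\<tau> i) (\<tau> (Suc i))" and J' = "\<lambda>i. j' (\<tau> i) (\<tau> (Suc i))"],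
          use step.IH step.prems k in simp)
  qed
next
  case (add n x y x' y')
  then show ?case by (simp add: distrib_right ordered_pair.add)
qed simp

text \<open>Induction on the right end: convolution splits off the last grid interval, and an empty
  interval contributes the counit.\<close>

lemma ordered_pair_times_process:
  assumes j: "braided_increments D T j" and j': "braided_increments D T j'" and \<tau>: "grid T m \<tau>"
  defines "R \<equiv> ordered_pair (\<lambda>i. j (\<tau> i) (\<tau> (Suc i))) (\<lambda>i. j' (\<tau> i) (\<tau> (Suc i)))"
  assumes "p \<le> q" "q \<le> m" "R m x y"
  shows "R m (x * j (\<tau> p) (\<tau> q) b) (y * j' (\<tau> p) (\<tau> q) b)"
  using assms(5-)
proof (induction q arbitrary: b rule: dec_induct)
  case base
  have "valid_interval T (\<tau> p) (\<tau> p)" using grid_valid_interval[OF \<tau>] base by simp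
  then have "j (\<tau> p) (\<tau> p) b = counit_of D b *\<^sub>C 1" "j' (\<tau> p) (\<tau> p) b = counit_of D b *\<^sub>C 1"
    using j j' by (simp_all add: braided_increments_def)
  then show ?case
    using ordered_pair_scaleC base(2) by (simp add: R_def scaleC_mult_right)
next
  case (step q)
  have v: "valid_interval T (\<tau> p) (\<tau> q)" "valid_interval T (\<tau> q) (\<tau> (Suc q))"
    using step grid_valid_interval[OF \<tau>] by auto
  have split: "x * h (\<tau> p) (\<tau> (Suc q)) b
      = tlift (\<lambda>b c. x * h (\<tau> p) (\<tau> q) b * h (\<tau> q) (\<tau> (Suc q)) c) (comult_of D b)"
    and bil: "cbilinear (\<lambda>b c. x * h (\<tau> p) (\<tau> q) b * h (\<tau> q) (\<tau> (Suc q)) c)"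
    if h: "braided_increments D T h" for h :: "real \<Rightarrow> real \<Rightarrow> 'a \<Rightarrow> 'x::star_algebra" and x
  proof -
    have l: "clinear (h (\<tau> p) (\<tau> q))" "clinear (h (\<tau> q) (\<tau> (Suc q)))"
      using h v by (auto simp: braided_increments_def)
    note lin' = lin clinear_compose[OF l(1)] clinear_compose[OF l(2)]
    show "cbilinear (\<lambda>b c. x * h (\<tau> p) (\<tau> q) b * h (\<tau> q) (\<tau> (Suc q)) c)" by (intro lin')
    have "h (\<tau> p) (\<tau> (Suc q)) b = convolve (comult_of D) (*) (h (\<tau> p) (\<tau> q)) (h (\<tau> q) (\<tau> (Suc q))) b"
      using h v unfolding braided_increments_def by metis
    then show "x * h (\<tau> p) (\<tau> (Suc q)) b
      = tlift (\<lambda>b c. x * h (\<tau> p) (\<tau> q) b * h (\<tau> q) (\<tau> (Suc q)) c) (comult_of D b)"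
      by (simp only: convolve_def) (subst times_tlift, (intro lin')+, simp only: mult.assoc)
  qed
  show ?case
    unfolding split[OF j] split[OF j'] R_def
    by (rule ordered_pair_tlift[OF bil[OF j] bil[OF j']])
      (rule ordered_pair_times_increment[OF j j' \<tau>], use step in \<open>simp_all add: R_def\<close>)
qed

lemma grid_through:
  assumes "finite S" "0 \<in> S" "S \<subseteq> {0..T}"
  obtains m \<tau> where "grid T m \<tau>"
    "\<And>s t. s \<in> S \<Longrightarrow> t \<in> S \<Longrightarrow> s \<le> t \<Longrightarrow> \<exists>p q. s = \<tau> p \<and> t = \<tau> q \<and> p \<le> q \<and> q \<le> m"
proof -
  define L where "L = sorted_list_of_set S"
  have L: "sorted L" "set L = S" "L \<noteq> []" using assms by (auto simp: L_def)
  have mono: "L ! p \<le> L ! q" if "p \<le> q" "q < length L" for p q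
    using that L(1) sorted_nth_mono by blast
  have "L ! 0 = 0"
  proof -
    obtain i where "i < length L" "L ! i = 0" using assms(2) L(2) by (metis in_set_conv_nth)
    then have "L ! 0 \<le> 0" using mono[of 0 i] by simp
    moreover have "L ! 0 \<in> S" using L by (metis length_greater_0_conv nth_mem)
    ultimately show ?thesis using assms(3) by (auto intro: antisym)
  qed
  moreover have "L ! (length L - 1) \<in> S" using L by (metis diff_less length_greater_0_conv nth_mem zero_less_one)
  ultimately have "grid T (length L - 1) ((!) L)"
    using assms(3) mono by (auto simp: grid_def)
  moreover have "\<exists>p q. s = L ! p \<and> t = L ! q \<and> p \<le> q \<and> q \<le> length L - 1"
    if st: "s \<in> S" "t \<in> S" "s \<le> t" for s t
  proof -
    obtain p q where pq: "p < length L" "q < length L" "s = L ! p" "t = L ! q"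
      using st(1,2) L(2) by (metis in_set_conv_nth)
    show ?thesis
    proof (cases "p \<le> q")
      \<comment> \<open>Sortedness now forces \<open>s = t\<close>, so one index serves for
        both.\<close>
      case False
      then have "s = t" using mono[of q p] pq st(3) by simp
      then show ?thesis using pq by (intro exI[of _ p]) auto
    next
      case True
      then show ?thesis using pq by (intro exI[of _ p] exI[of _ q]) auto
    qed
  qed
  ultimately show ?thesis by (rule that)
qed

text \<open>All endpoints are put on one grid. Multiplying 1 by the given factors one after the
  other stays within the ordered pairs, so a joint moment is a combination of ordered grid moments,
  the same combination for both processes.\<close>

lemma equivalent_if_grid_moments_eq:
  fixes j :: "real \<Rightarrow> real \<Rightarrow> 'd::complex_vector \<Rightarrow> 'e::star_algebra"
    and j' :: "real \<Rightarrow> real \<Rightarrow> 'd \<Rightarrow> 'f::star_algebra"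
  assumes j: "braided_increments D T j" and j': "braided_increments D T j'" and "0 \<le> T"
    and \<Phi>: "clinear \<Phi>" "clinear \<Phi>'"
    and moments: "\<And>n \<tau> b. grid T n \<tau> \<Longrightarrow>
      \<Phi> (prod_list (map (\<lambda>i. j (\<tau> i) (\<tau> (Suc i)) (b i)) [0..<n]))
      = \<Phi>' (prod_list (map (\<lambda>i. j' (\<tau> i) (\<tau> (Suc i)) (b i)) [0..<n]))"
  shows "equivalent_processes T \<Phi> j \<Phi>' j'"
  unfolding equivalent_processes_def
proof (intro allI impI)
  fix xs :: "(real \<times> real \<times> 'd) list"
  assume xs: "\<forall>(s, t, b) \<in> set xs. 0 \<le> s \<and> s \<le> t \<and> t \<le> T"
  define S where "S = insert 0 (fst ` set xs \<union> (fst \<circ> snd) ` set xs)"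
  have "finite S" "0 \<in> S" "S \<subseteq> {0..T}" using xs \<open>0 \<le> T\<close> by (fastforce simp: S_def)+
  then obtain m \<tau> where \<tau>: "grid T m \<tau>"
    and ends: "\<And>s t. s \<in> S \<Longrightarrow> t \<in> S \<Longrightarrow> s \<le> t \<Longrightarrow> \<exists>p q. s = \<tau> p \<and> t = \<tau> q \<and> p \<le> q \<and> q \<le> m"
    using grid_through by blast
  define R where "R = ordered_pair (\<lambda>i. j (\<tau> i) (\<tau> (Suc i))) (\<lambda>i. j' (\<tau> i) (\<tau> (Suc i)))"
  \<comment> \<open>The starting point of the multiplication: 1 is the ordered product of the values
    at the unit.\<close>
  have one: "R n 1 1" if "n \<le> m" for n
    using that
  proof (induction n)
    case 0
    show ?case unfolding R_def
      using ordered_pair.const[of "\<lambda>i. j (\<tau> i) (\<tau> (Suc i))" "\<lambda>i. j' (\<tau> i) (\<tau> (Suc i))" 1] by (simp add: scaleC_one)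
  next
    case (Suc n)
    have "valid_interval T (\<tau> n) (\<tau> (Suc n))" using grid_valid_interval[OF \<tau>] Suc by simp
    then have "j (\<tau> n) (\<tau> (Suc n)) (unit_of D) = 1" "j' (\<tau> n) (\<tau> (Suc n)) (unit_of D) = 1"
      using j j' by (simp_all add: braided_increments_def)
    then show ?case
      using ordered_pair.step[OF Suc.IH[unfolded R_def], of "unit_of D"] Suc.prems by (simp add: R_def)
  qed
  have "R m (x * prod_list (map (\<lambda>(s, t, b). j s t b) ys)) (y * prod_list (map (\<lambda>(s, t, b). j' s t b) ys))"
    if "set ys \<subseteq> set xs" "R m x y" for ys x y
    using that
  proof (induction ys arbitrary: x y)
    case (Cons z ys)
    obtain s t b where z: "z = (s, t, b)" by (cases z)
    then have "(s, t, b) \<in> set xs" using Cons.prems(1) by simp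
    then have "s \<in> S" "t \<in> S" "s \<le> t" using xs by (force simp: S_def)+
    then obtain p q where pq: "s = \<tau> p" "t = \<tau> q" "p \<le> q" "q \<le> m" using ends by blast
    then have "R m (x * j s t b) (y * j' s t b)"
      using ordered_pair_times_process[OF j j' \<tau>] Cons.prems(2) by (simp add: R_def)
    then show ?case using Cons by (simp add: z flip: mult.assoc)
  qed simp
  from this[OF order_refl one[OF order_refl]]
  have "R m (prod_list (map (\<lambda>(s, t, b). j s t b) xs)) (prod_list (map (\<lambda>(s, t, b). j' s t b) xs))"
    by simp
  from ordered_pair_moment[OF \<Phi> moments[OF grid_le[OF \<tau>]] this[unfolded R_def] order_refl]
  show "\<Phi> (prod_list (map (\<lambda>(s, t, b). j s t b) xs)) = \<Phi>' (prod_list (map (\<lambda>(s, t, b). j' s t b) xs))" .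
qed

lemma levy_process_braided_increments:
  assumes levy: "levy_process D T \<Phi> j"
  shows "braided_increments D T j"
proof -
  have "tlift (\<lambda>b c. j s' t' b * j s t c) x = tlift (\<lambda>b c. j s t b * j s' t' c) (braiding_of D x)"
    if v: "valid_interval T s t" "valid_interval T s' t'" "t \<le> s'" for s t s' t' x
  proof -
    \<comment> \<open>The two intervals as a tuple of length 2; the relation is the commutation part
      of independence for the indices 0 and 1.\<close>
    define S where "S i = (if i = 0 then s else s')" for i :: nat
    define E where "E i = (if i = 0 then t else t')" for i :: nat
    have "(\<forall>i<2. 0 \<le> S i \<and> S i \<le> E i \<and> E i \<le> T) \<and> (\<forall>i. Suc i < 2 \<longrightarrow> E i \<le> S (Suc i))"
      using v by (auto simp: S_def E_def valid_interval_def)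
    then have "braided_independent D \<Phi> 2 (\<lambda>i. j (S i) (E i))"
      using levy by (simp add: levy_process_def)
    then have "\<forall>k l. k < l \<and> l < 2 \<longrightarrow> (\<forall>z. tlift (\<lambda>b c. j (S l) (E l) b * j (S k) (E k) c) z
        = tlift (\<lambda>b c. j (S k) (E k) b * j (S l) (E l) c) (braiding_of D z))"
      unfolding braided_independent_def by (rule conjunct2)
    from this[rule_format, of 0 1 x] show ?thesis by (simp add: S_def E_def)
  qed
  then show ?thesis
    using levy by (simp add: braided_increments_def levy_process_def unital_star_hom_def valid_interval_def)
qed


section \<open>Processes on the symmetrization\<close>

context braided_algebra
begin

abbreviation "H \<equiv> symmetrization \<Delta>A \<epsilon>A act \<gamma> \<Delta>B \<epsilon>B"

lemma symmetrization_mult: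
  "mult_of H (b \<otimes> a) (d \<otimes> c) = tlift (\<lambda>a1 a2. (b * act a1 d) \<otimes> (a2 * c)) (\<Delta>A a)"
proof -
  have b: "cbilinear (\<lambda>b a. tlift (\<lambda>d c. tlift (\<lambda>a1 a2. (b * act a1 d) \<otimes> (a2 * c)) (\<Delta>A a)) (d \<otimes> c))"
    "cbilinear (\<lambda>d c. tlift (\<lambda>a1 a2. (b * act a1 d) \<otimes> (a2 * c)) (\<Delta>A a))"
    "cbilinear (\<lambda>b a. tlift (\<lambda>a1 a2. (b * act a1 d) \<otimes> (a2 * c)) (\<Delta>A a))" for b a d c
    by (intro lin_maps)+
  show ?thesis
    by (simp only: symmetrization_def bialgebra_structure.simps tlift_tensor[OF b(1)]
        tlift_tensor[OF b(2)] tlift_tensor[OF b(3)])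
qed

lemma symmetrization_mult_one_right: "mult_of H (b \<otimes> 1) (d \<otimes> c) = (b * d) \<otimes> c"
  unfolding symmetrization_mult \<Delta>A_one
  by (subst tlift_tensor, (intro lin_maps)+) (simp add: act_one)

lemma symmetrization_mult_one_left: "mult_of H (1 \<otimes> a) (b \<otimes> 1) = tlift (\<lambda>a1 a2. act a1 b \<otimes> a2) (\<Delta>A a)"
  by (simp add: symmetrization_mult)

lemma symmetrization_mult_one: "mult_of H (1 \<otimes> a) (1 \<otimes> c) = 1 \<otimes> (a * c)"
  unfolding symmetrization_mult act_unit
  using counit_left[OF coA \<epsilon>A_linear, of "\<lambda>x. 1 \<otimes> (x * c)"]
  by (simp add: lin_maps tensor_scaleC_left)

lemma symmetrization_star:
  "star_of H (b \<otimes> a) = tlift (\<lambda>a1 a2. act a1 (star b) \<otimes> a2) (\<Delta>A (star a))"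
proof -
  have G: "cbilinear (\<lambda>a1 a2. act a1 b \<otimes> a2)" for b by (intro lin_maps)
  have b: "cbilinear (\<lambda>b a. tlift (\<lambda>a1 a2. act a1 b \<otimes> a2) (\<Delta>A a))" by (intro lin_maps)
  then have "biantilinear (\<lambda>b a. tlift (\<lambda>a1 a2. act a1 (star b) \<otimes> a2) (\<Delta>A (star a)))"
    by (simp add: biantilinear_def antilinear_def cbilinear_def clinear_iff star_add star_scaleC)
  from tlift_anti_tensor[OF this] show ?thesis
    by (simp add: symmetrization_def tlift_anti_star[OF G] \<Delta>A_star)
qed

lemma symmetrization_star_left: "star_of H (b \<otimes> 1) = star b \<otimes> 1"
  unfolding symmetrization_star star_one \<Delta>A_one
  by (subst tlift_tensor, (intro lin_maps)+) (simp add: act_one)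

lemma symmetrization_star_right: "star_of H (1 \<otimes> a) = 1 \<otimes> star a"
  unfolding symmetrization_star star_one act_unit
  using counit_left[OF coA \<epsilon>A_linear, of "\<lambda>x. 1 \<otimes> x"]
  by (simp add: lin_maps flip: tensor_scaleC_left)

lemma symmetrization_comult:
  "comult_of H (b \<otimes> a) = tlift (\<lambda>b1 b2. tlift (\<lambda>u v. tlift (\<lambda>a1 a2.
    (b1 \<otimes> (u * a1)) \<otimes> (v \<otimes> a2)) (\<Delta>A a)) (\<gamma> b2)) (\<Delta>B b)"
proof -
  have b: "cbilinear (\<lambda>b a. tlift (\<lambda>b1 b2. tlift (\<lambda>u v. tlift (\<lambda>a1 a2.
    (b1 \<otimes> (u * a1)) \<otimes> (v \<otimes> a2)) (\<Delta>A a)) (\<gamma> b2)) (\<Delta>B b))"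
    by (intro lin_maps)
  show ?thesis
    by (simp only: symmetrization_def bialgebra_structure.simps tlift_tensor[OF b])
qed

text \<open>\<open>\<Delta>B\<close> and \<open>\<gamma>\<close> send 1 to
  \<open>1 \<otimes> 1\<close>, so the coproduct of \<open>1 \<otimes> a\<close> stays in the second
  tensor factor.\<close>

lemma symmetrization_convolve_right:
  assumes f: "clinear f" and g: "clinear g"
  shows "convolve (comult_of H) (*) f g (1 \<otimes> a) = tlift (\<lambda>a1 a2. f (1 \<otimes> a1) * (g (1 \<otimes> a2) :: 'x::star_algebra)) (\<Delta>A a)"
proof -
  note lin' = lin_maps clinear_compose[OF f] clinear_compose[OF g]
  have "comult_of H (1 \<otimes> a) = tlift (\<lambda>a1 a2. (1 \<otimes> a1) \<otimes> (1 \<otimes> a2)) (\<Delta>A a)"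
    unfolding symmetrization_comult \<Delta>B_one
    by (subst tlift_tensor, (intro lin_maps)+, unfold \<gamma>_one, subst tlift_tensor, (intro lin_maps)+) simp
  moreover have "cbilinear (\<lambda>x y. f x * g y)" by (intro lin')
  ultimately show ?thesis
    unfolding convolve_def by (simp add: tlift_tlift tlift_tensor lin_maps)
qed

text \<open>The leg \<open>u\<close> of the coaction enters the argument of \<open>f\<close>; once
  \<open>b1 \<otimes> u\<close> is factored, it becomes the \<open>I\<close> in
  \<open>K_convolve\<close>.\<close>

lemma symmetrization_convolve_left:
  assumes f: "clinear f" and g: "clinear g"
  shows "convolve (comult_of H) (*) f g (b \<otimes> 1)
    = tlift (\<lambda>b1 b2. tlift (\<lambda>u v. f (b1 \<otimes> u) * (g (v \<otimes> 1) :: 'x::star_algebra)) (\<gamma> b2)) (\<Delta>B b)"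
proof -
  note lin' = lin_maps clinear_compose[OF f] clinear_compose[OF g]
  have "comult_of H (b \<otimes> 1) = tlift (\<lambda>b1 b2. tlift (\<lambda>u v. (b1 \<otimes> u) \<otimes> (v \<otimes> 1)) (\<gamma> b2)) (\<Delta>B b)"
    unfolding symmetrization_comult \<Delta>A_one
    by (subst tlift_tensor, (intro lin_maps)+) simp
  moreover have "cbilinear (\<lambda>x y. f x * g y)" by (intro lin')
  ultimately show ?thesis
    unfolding convolve_def by (simp add: tlift_tlift tlift_tensor lin_maps)
qed

lemma symmetrization_counit: "counit_of H (b \<otimes> a) = \<epsilon>B b * \<epsilon>A a"
proof -
  have b: "cbilinear (\<lambda>b a. \<epsilon>B b * \<epsilon>A a)" by (intro lin_maps)
  show ?thesis by (simp only: symmetrization_def bialgebra_structure.simps tlift_tensor[OF b])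
qed

lemma symmetrization_unit: "unit_of H = 1 \<otimes> 1"
  and symmetrization_braiding: "braiding_of H = flip"
  by (simp_all add: symmetrization_def)

lemma hom_pure_tensor:
  assumes "unital_star_hom H f"
  shows "f (b \<otimes> 1) * f (1 \<otimes> a) = f (b \<otimes> a)"
proof -
  have "f (mult_of H (b \<otimes> 1) (1 \<otimes> a)) = f (b \<otimes> 1) * f (1 \<otimes> a)"
    using assms by (simp only: unital_star_hom_def)
  then show ?thesis by (simp add: symmetrization_mult_one_right)
qed

lemma levy_process_split:
  assumes levy: "levy_process H T \<Phi> jH"
  shows "split_process \<Delta>A \<epsilon>A act \<gamma> \<Delta>B \<epsilon>B T (\<lambda>s t a. jH s t (1 \<otimes> a)) (\<lambda>s t b. jH s t (b \<otimes> 1))"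
proof -
  have hom: "unital_star_hom H (jH s t)" if "valid_interval T s t" for s t
    using levy that by (simp add: levy_process_def valid_interval_def)
  have lin_j: "clinear (jH s t)" and j_one: "jH s t (1 \<otimes> 1) = 1"
    and j_mult: "jH s t (mult_of H x y) = jH s t x * jH s t y"
    and j_star: "jH s t (star_of H x) = star (jH s t x)" if "valid_interval T s t" for s t x y
    using hom[OF that] by (simp_all add: unital_star_hom_def symmetrization_unit)
  have conv: "jH r t x = convolve (comult_of H) (*) (jH r s) (jH s t) x"
    if "valid_interval T r s" "valid_interval T s t" for r s t x
    using levy that by (simp add: levy_process_def valid_interval_def)
  have j_refl: "jH t t x = counit_of H x *\<^sub>C 1" if "valid_interval T t t" for t x
    using levy that by (simp add: levy_process_def valid_interval_def)
  \<comment> \<open>For the flip, the braided relation on pure tensors is ordinary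
    commutation.\<close>
  have comm: "jH s' t' x * jH s t y = jH s t y * jH s' t' x"
    if v: "valid_interval T s t" "valid_interval T s' t'" "t \<le> s'" for s t s' t' x y
  proof -
    have c: "tlift (\<lambda>b c. jH s' t' b * jH s t c) z = tlift (\<lambda>b c. jH s t b * jH s' t' c) (flip z)" for z
      using levy_process_braided_increments[OF levy] v
      by (simp add: braided_increments_def symmetrization_braiding)
    have b: "cbilinear (\<lambda>b c. jH s t b * jH s' t' c)" "cbilinear (\<lambda>b c. jH s' t' b * jH s t c)"
      by (intro lin clinear_compose[OF lin_j[OF v(1)]] clinear_compose[OF lin_j[OF v(2)]])+
    show ?thesis
      using c[of "x \<otimes> y"] by (simp only: flip_tensor tlift_tensor[OF b(1)] tlift_tensor[OF b(2)])
  qed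
  have pure: "jH s t (b \<otimes> a) = jH s t (b \<otimes> 1) * jH s t (1 \<otimes> a)" if "valid_interval T s t" for s t b a
    by (rule hom_pure_tensor[OF hom[OF that], symmetric])
  show ?thesis
  proof (intro split_process.intro split_process_axioms.intro braided_algebra_axioms)
    fix s t a b
    assume v: "valid_interval T s t"
    show "clinear (\<lambda>a. jH s t (1 \<otimes> a))" "clinear (\<lambda>b. jH s t (b \<otimes> 1))"
      by (intro lin clinear_compose[OF lin_j[OF v]])+
    have "jH s t (1 \<otimes> a) * jH s t (b \<otimes> 1) = tlift (\<lambda>a1 a2. jH s t (act a1 b \<otimes> a2)) (\<Delta>A a)"
      unfolding j_mult[OF v, symmetric] symmetrization_mult_one_left
      by (rule tlift_linear[OF lin_j[OF v]]) (intro lin_maps)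
    also have "\<dots> = tlift (\<lambda>a1 a2. jH s t (act a1 b \<otimes> 1) * jH s t (1 \<otimes> a2)) (\<Delta>A a)"
      by (subst pure[OF v]) (rule refl)
    finally show "jH s t (1 \<otimes> a) * jH s t (b \<otimes> 1)
      = tlift (\<lambda>a1 a2. jH s t (act a1 b \<otimes> 1) * jH s t (1 \<otimes> a2)) (\<Delta>A a)" .
  next
    fix r s t a b
    assume v: "valid_interval T r s" "valid_interval T s t"
    show "jH r t (1 \<otimes> a) = tlift (\<lambda>a1 a2. jH r s (1 \<otimes> a1) * jH s t (1 \<otimes> a2)) (\<Delta>A a)"
      unfolding conv[OF v] by (rule symmetrization_convolve_right[OF lin_j[OF v(1)] lin_j[OF v(2)]])
    show "jH r t (b \<otimes> 1) = tlift (\<lambda>b1 b2. tlift (\<lambda>u v. jH r s (b1 \<otimes> 1) * jH r s (1 \<otimes> u) * jH s t (v \<otimes> 1)) (\<gamma> b2)) (\<Delta>B b)"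
      unfolding conv[OF v] symmetrization_convolve_left[OF lin_j[OF v(1)] lin_j[OF v(2)]]
      by (subst pure[OF v(1)]) (rule refl)
  qed (simp_all add: j_one comm j_refl symmetrization_counit \<epsilon>A_one \<epsilon>B_one symmetrization_mult_one
      symmetrization_mult_one_right symmetrization_star_left symmetrization_star_right
      flip: j_mult j_star)
qed

end

section \<open>Expectations of ordered products\<close>

lemma prod_list_upt: "prod_list (map f [0..<n]) = (\<Prod>i<n. f i :: 'a::comm_monoid_mult)"
  by (induction n) simp_all

lemma levy_process_grid_moments:
  assumes "levy_process D T \<Phi> j" "grid T n \<tau>"
  shows "\<Phi> (prod_list (map (\<lambda>i. j (\<tau> i) (\<tau> (Suc i)) (b i)) [0..<n])) = (\<Prod>i<n. \<Phi> (j (\<tau> i) (\<tau> (Suc i)) (b i)))"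
proof -
  have "valid_interval T (\<tau> i) (\<tau> (Suc i))" if "i < n" for i
    using grid_valid_interval[OF assms(2), of i "Suc i"] that by simp
  then have "(\<forall>i<n. 0 \<le> \<tau> i \<and> \<tau> i \<le> \<tau> (Suc i) \<and> \<tau> (Suc i) \<le> T) \<and> (\<forall>i. Suc i < n \<longrightarrow> \<tau> (Suc i) \<le> \<tau> (Suc i))"
    by (simp add: valid_interval_def)
  then have "braided_independent D \<Phi> n (\<lambda>i. j (\<tau> i) (\<tau> (Suc i)))"
    using assms(1) by (simp add: levy_process_def)
  then have "\<forall>\<sigma> b. \<sigma> permutes {..<n} \<longrightarrow> \<Phi> (prod_list (map (\<lambda>k. j (\<tau> (\<sigma> k)) (\<tau> (Suc (\<sigma> k))) (b k)) [0..<n]))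
      = (\<Prod>k<n. \<Phi> (j (\<tau> (\<sigma> k)) (\<tau> (Suc (\<sigma> k))) (b k)))"
    unfolding braided_independent_def by (rule conjunct1)
  from this[rule_format, OF permutes_id] show ?thesis by simp
qed

text \<open>The elements \<open>J i (b, c)\<close>, which stand for \<open>b \<otimes> c\<close> on
  the grid interval \<open>i\<close>, are paired with the numbers \<open>J' i (b, c)\<close>. As the
  second family is scalar, \<open>ordered_pair_moment\<close> with the identity as second functional
  evaluates \<open>\<Phi>\<close> on products of \<open>hat\<close>.\<close>

lemma (in split_process) hat_grid_moment:
  assumes \<Phi>: "clinear \<Phi>" and \<phi>: "\<And>s t. valid_interval T s t \<Longrightarrow> clinear (\<phi> (t - s))"
    and \<tau>: "grid T n \<tau>"
    and moments: "\<And>n b c. grid T n \<tau> \<Longrightarrow>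
      \<Phi> (prod_list (map (\<lambda>i. K (\<tau> i) (\<tau> (Suc i)) (b i) * I (\<tau> i) (\<tau> (Suc i)) (c i)) [0..<n]))
      = (\<Prod>i<n. \<phi> (\<tau> (Suc i) - \<tau> i) (b i) * \<epsilon>A (c i))"
  shows "\<Phi> (prod_list (map (\<lambda>i. hat (\<tau> i) (\<tau> (Suc i)) (b i)) [0..<n])) = (\<Prod>i<n. \<phi> (\<tau> (Suc i) - \<tau> i) (b i))"
proof -
  define J where "J i x = K (\<tau> i) (\<tau> (Suc i)) (fst x) * I (\<tau> i) (\<tau> (Suc i)) (snd x)" for i x
  define J' where "J' i x = \<phi> (\<tau> (Suc i) - \<tau> i) (fst x) * \<epsilon>A (snd x)" for i x
  \<comment> \<open>To the right of an ordered product, \<open>I 0 (\<tau> k) a\<close> counts as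
    the number \<open>\<epsilon>A a\<close>: convolution distributes it over the grid intervals,
    where the second components absorb it.\<close>
  have shift: "ordered_pair J J' k x z \<Longrightarrow> k \<le> n \<Longrightarrow>
    ordered_pair J J' k (x * I 0 (\<tau> k) a) (z * \<epsilon>A a)" for k x z a
  proof (induction arbitrary: a rule: ordered_pair.induct)
    case (const c)
    \<comment> \<open>With no factor left, \<open>I\<close> lives on the empty interval at 0 and is
      the counit.\<close>
    have "\<tau> 0 = 0" "valid_interval T 0 0" using \<tau> grid_valid_interval[OF \<tau>, of 0 0] by (simp_all add: grid_def)
    then have "c *\<^sub>C 1 * I 0 (\<tau> 0) a = (c * \<epsilon>A a) *\<^sub>C 1" by (simp add: I_refl scaleC_mult_left scaleC_scaleC)
    moreover have "c *\<^sub>C 1 * \<epsilon>A a = (c * \<epsilon>A a) *\<^sub>C 1" by (simp add: scaleC_complex_def)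
    ultimately show ?case by (simp only: ordered_pair.const)
  next
    case (step k x z y)
    obtain b c where y: "y = (b, c)" by (cases y)
    have v: "valid_interval T 0 (\<tau> k)" "valid_interval T (\<tau> k) (\<tau> (Suc k))"
      using grid_valid_interval[OF \<tau>, of 0 k] grid_valid_interval[OF \<tau>, of k "Suc k"] step.prems \<tau>
      by (simp_all add: grid_def)
    note lin' = lin_maps linI[OF v(1)] linI[OF v(2)] linK[OF v(2)]
    \<comment> \<open>The leg \<open>a1\<close> moves to the left of \<open>J k\<close> and is left
      to the induction hypothesis; the leg \<open>a2\<close> multiplies \<open>c\<close> from the
      right.\<close>
    let ?F = "\<lambda>a1 a2. x * I 0 (\<tau> k) a1 * J k (b, c * a2)"
    let ?F' = "\<lambda>a1 a2. z * \<epsilon>A a1 * J' k (b, c * a2)"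
    have bil: "cbilinear ?F" "cbilinear ?F'" unfolding J_def J'_def fst_conv snd_conv by (intro lin')+
    have c: "I (\<tau> k) (\<tau> (Suc k)) c * I 0 (\<tau> k) a1 = I 0 (\<tau> k) a1 * I (\<tau> k) (\<tau> (Suc k)) c"
      "K (\<tau> k) (\<tau> (Suc k)) b * I 0 (\<tau> k) a1 = I 0 (\<tau> k) a1 * K (\<tau> k) (\<tau> (Suc k)) b" for a1
      by (rule commute(1,3)[OF v order_refl])+
    have "I (\<tau> k) (\<tau> (Suc k)) c * (I 0 (\<tau> k) a1 * w) = I 0 (\<tau> k) a1 * (I (\<tau> k) (\<tau> (Suc k)) c * w)"
      "K (\<tau> k) (\<tau> (Suc k)) b * (I 0 (\<tau> k) a1 * w) = I 0 (\<tau> k) a1 * (K (\<tau> k) (\<tau> (Suc k)) b * w)" for a1 w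
      by (simp_all add: c flip: mult.assoc)
    then have "J k (b, c) * (I 0 (\<tau> k) a1 * I (\<tau> k) (\<tau> (Suc k)) a2) = I 0 (\<tau> k) a1 * J k (b, c * a2)" for a1 a2
      unfolding J_def fst_conv snd_conv I_mult[OF v(2)] by (simp add: mult.assoc)
    then have "x * J k y * I 0 (\<tau> (Suc k)) a = tlift ?F (\<Delta>A a)"
      unfolding y I_convolve[OF v] by (subst times_tlift, (intro lin')+) (simp add: mult.assoc)
    moreover have "z * J' k y * \<epsilon>A a = tlift ?F' (\<Delta>A a)"
    proof -
      have "tlift ?F' (\<Delta>A a) = tlift (\<lambda>a1 a2. \<epsilon>A a1 *\<^sub>C (z * J' k y * \<epsilon>A a2)) (\<Delta>A a)"
        by (simp add: J'_def y \<epsilon>A_mult scaleC_complex_def mult_ac)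
      also have "\<dots> = z * J' k y * \<epsilon>A a"
        by (rule counit_left[OF coA \<epsilon>A_linear]) (intro lin' \<epsilon>A_linear)
      finally show ?thesis ..
    qed
    moreover have "ordered_pair J J' (Suc k) (tlift ?F (\<Delta>A a)) (tlift ?F' (\<Delta>A a))"
      by (rule ordered_pair_tlift[OF bil], rule ordered_pair.step, rule step.IH)
        (use step.prems in simp)
    ultimately show ?case by simp
  qed (simp add: distrib_right ordered_pair.add)
  have "ordered_pair J J' k (prod_list (map (\<lambda>i. hat (\<tau> i) (\<tau> (Suc i)) (b i)) [0..<k]))
      (\<Prod>i<k. \<phi> (\<tau> (Suc i) - \<tau> i) (b i))" if "k \<le> n" for k
    using that
  proof (induction k)
    case 0
    then show ?case using ordered_pair.const[of J J' 1] by (simp add: scaleC_one)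
  next
    case (Suc k)
    let ?x = "prod_list (map (\<lambda>i. hat (\<tau> i) (\<tau> (Suc i)) (b i)) [0..<k])"
    let ?z = "\<Prod>i<k. \<phi> (\<tau> (Suc i) - \<tau> i) (b i)"
    have v: "valid_interval T 0 (\<tau> k)" "valid_interval T (\<tau> k) (\<tau> (Suc k))"
      using grid_valid_interval[OF \<tau>, of 0 k] grid_valid_interval[OF \<tau>, of k "Suc k"] Suc.prems \<tau>
      by (simp_all add: grid_def)
    note lin' = lin_maps linI[OF v(1)] linI[OF v(2)] linK[OF v(2)] clinear_compose[OF \<phi>[OF v(2)]]
    \<comment> \<open>\<open>K\<close> alone is \<open>J\<close> with second component 1. The factor
      \<open>I 0 (\<tau> k) u\<close> is handled by \<open>shift\<close>, and the counit law of the
      coaction sums the values \<open>\<epsilon>A u\<close> away.\<close>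
    let ?F = "\<lambda>u v. ?x * I 0 (\<tau> k) u * J k (v, 1)"
    let ?F' = "\<lambda>u v. ?z * \<epsilon>A u * J' k (v, 1)"
    have bil: "cbilinear ?F" "cbilinear ?F'" unfolding J_def J'_def fst_conv snd_conv by (intro lin')+
    have "?x * hat (\<tau> k) (\<tau> (Suc k)) (b k) = tlift ?F (\<gamma> (b k))"
      unfolding hat_def[of "\<tau> k"] J_def
      by (subst times_tlift, (intro lin')+) (simp add: I_one[OF v(2)] mult.assoc)
    moreover have "?z * \<phi> (\<tau> (Suc k) - \<tau> k) (b k) = tlift ?F' (\<gamma> (b k))"
    proof -
      have "tlift ?F' (\<gamma> (b k)) = tlift (\<lambda>u v. \<epsilon>A u *\<^sub>C (?z * \<phi> (\<tau> (Suc k) - \<tau> k) v)) (\<gamma> (b k))"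
        by (simp add: J'_def \<epsilon>A_one scaleC_complex_def mult_ac)
      also have "\<dots> = ?z * \<phi> (\<tau> (Suc k) - \<tau> k) (b k)"
        by (rule comodule_counit[OF comod \<epsilon>A_linear]) (intro lin' \<phi>[OF v(2)])
      finally show ?thesis ..
    qed
    moreover have "ordered_pair J J' (Suc k) (tlift ?F (\<gamma> (b k))) (tlift ?F' (\<gamma> (b k)))"
      by (rule ordered_pair_tlift[OF bil], rule ordered_pair.step, rule shift, rule Suc.IH)
        (use Suc.prems in simp_all)
    ultimately show ?case by simp
  qed
  from this[OF order_refl] show ?thesis
  proof (rule ordered_pair_moment[OF \<Phi> clinear_ident _ _ order_refl, rotated])
    fix x k assume "k \<le> n"
    then show "\<Phi> (prod_list (map (\<lambda>i. J i (x i)) [0..<k])) = prod_list (map (\<lambda>i. J' i (x i)) [0..<k])"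
      using moments[OF grid_le[OF \<tau>], of k "\<lambda>i. fst (x i)" "\<lambda>i. snd (x i)"]
      by (simp add: J_def J'_def prod_list_upt)
  qed
qed


lemma (in split_process) hat_braided_increments:
  "braided_increments (braided_structure act \<gamma> \<Delta>B \<epsilon>B) T hat"
  unfolding braided_increments_def braided_structure_def
  by (simp add: hat_linear hat_one hat_mult hat_refl fun_eq_iff convolve_def hat_convolve hat_braided_commute)

section \<open>Transfer of the defining properties along equivalence\<close>

lemma single_moment_eq:
  assumes "equivalent_processes T \<Phi> j \<Phi>' j'" "valid_interval T s t"
  shows "\<Phi> (j s t b) = \<Phi>' (j' s t b)"
  using assms(1)[unfolded equivalent_processes_def, rule_format, of "[(s, t, b)]"] assms(2)
  by (simp add: valid_interval_def)

text \<open>Factorization of expectations, stationarity and continuity concern joint moments only,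
  so equivalence carries them over from \<open>j\<close>. Intervals in a joint moment may come in
  any order, which covers every permutation \<open>\<sigma>\<close>. The algebraic conditions come
  from \<open>inc\<close> and \<open>star\<close>.\<close>

lemma levy_process_of_equivalent:
  fixes j :: "real \<Rightarrow> real \<Rightarrow> 'd::complex_vector \<Rightarrow> 'e::star_algebra"
    and j' :: "real \<Rightarrow> real \<Rightarrow> 'd \<Rightarrow> 'f::star_algebra"
  assumes levy: "levy_process D T \<Phi> j" and equiv: "equivalent_processes T \<Phi>' j' \<Phi> j"
    and \<Phi>': "state \<Phi>'" and inc: "braided_increments D T j'"
    and star: "\<And>s t x. valid_interval T s t \<Longrightarrow> j' s t (star_of D x) = star (j' s t x)"
  shows "levy_process D T \<Phi>' j'"
proof -
  note single = single_moment_eq[OF equiv]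
  have "braided_independent D \<Phi>' n (\<lambda>i. j' (s i) (t i))"
    if st: "\<forall>i<n. 0 \<le> s i \<and> s i \<le> t i \<and> t i \<le> T" "\<forall>i. Suc i < n \<longrightarrow> t i \<le> s (Suc i)"
    for n s t
    unfolding braided_independent_def
  proof (intro conjI allI impI)
    fix \<sigma> and b :: "nat \<Rightarrow> 'd" assume \<sigma>: "\<sigma> permutes {..<n}"
    have v: "valid_interval T (s (\<sigma> k)) (t (\<sigma> k))" if "k < n" for k
      using st(1) permutes_in_image[OF \<sigma>, of k] that by (simp add: valid_interval_def)
    let ?xs = "map (\<lambda>k. (s (\<sigma> k), t (\<sigma> k), b k)) [0..<n]"
    have "\<forall>(s, t, b) \<in> set ?xs. 0 \<le> s \<and> s \<le> t \<and> t \<le> T"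
      using v by (auto simp: valid_interval_def)
    from equiv[unfolded equivalent_processes_def, THEN spec, THEN mp, OF this]
    have "\<Phi>' (prod_list (map (\<lambda>k. j' (s (\<sigma> k)) (t (\<sigma> k)) (b k)) [0..<n]))
      = \<Phi> (prod_list (map (\<lambda>k. j (s (\<sigma> k)) (t (\<sigma> k)) (b k)) [0..<n]))"
      by (simp add: o_def)
    also have "\<dots> = (\<Prod>k<n. \<Phi> (j (s (\<sigma> k)) (t (\<sigma> k)) (b k)))"
    proof -
      have "braided_independent D \<Phi> n (\<lambda>i. j (s i) (t i))"
        using levy st by (simp add: levy_process_def)
      then show ?thesis using \<sigma> by (simp add: braided_independent_def)
    qed
    also have "\<dots> = (\<Prod>k<n. \<Phi>' (j' (s (\<sigma> k)) (t (\<sigma> k)) (b k)))"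
      by (rule prod.cong) (simp_all add: single v)
    finally show "\<Phi>' (prod_list (map (\<lambda>k. j' (s (\<sigma> k)) (t (\<sigma> k)) (b k)) [0..<n]))
      = (\<Prod>k<n. \<Phi>' (j' (s (\<sigma> k)) (t (\<sigma> k)) (b k)))" .
  next
    fix k l x assume kl: "k < l \<and> l < n"
    \<comment> \<open>Only neighbouring intervals are compared by assumption; the order of distant
      ones follows through those in between.\<close>
    have "t k \<le> s l"
    proof -
      have "Suc k \<le> l" using kl by simp
      then have "s (Suc k) \<le> s l"
        using kl
      proof (induction l rule: dec_induct)
        case (step m)
        then have "s m \<le> t m" "t m \<le> s (Suc m)" using st by auto
        with step show ?case by simp
      qed simp
      moreover have "t k \<le> s (Suc k)" using st(2) kl by simp
      ultimately show ?thesis by simp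
    qed
    then show "tlift (\<lambda>b c. j' (s l) (t l) b * j' (s k) (t k) c) x
      = tlift (\<lambda>b c. j' (s k) (t k) b * j' (s l) (t l) c) (braiding_of D x)"
      using inc st(1) kl by (simp add: braided_increments_def valid_interval_def)
  qed
  moreover have "\<Phi>' \<circ> j' s t = \<Phi>' \<circ> j' u v"
    if "valid_interval T s t" "valid_interval T u v" "t - s = v - u" for s t u v
  proof -
    have "\<Phi> \<circ> j s t = \<Phi> \<circ> j u v"
      using levy that by (simp add: levy_process_def valid_interval_def)
    then show ?thesis using single that by (simp add: fun_eq_iff)
  qed
  moreover have "((\<lambda>t. \<Phi>' (j' s t b)) \<longlongrightarrow> counit_of D b) (at s within {s<..T})"
    if s: "0 \<le> s" "s \<le> T" for b s
  proof -
    have "((\<lambda>t. \<Phi> (j s t b)) \<longlongrightarrow> counit_of D b) (at s within {s<..T})"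
      using levy s by (simp add: levy_process_def)
    moreover have "\<forall>\<^sub>F t in at s within {s<..T}. \<Phi>' (j' s t b) = \<Phi> (j s t b)"
      using s by (auto simp: eventually_at_filter valid_interval_def intro!: always_eventually single)
    ultimately show ?thesis by (simp add: tendsto_cong)
  qed
  ultimately show ?thesis
    using \<Phi>' inc star
    by (auto simp: levy_process_def braided_increments_def unital_star_hom_def valid_interval_def)
qed

theorem theorem5p4p3:
  fixes \<Delta>A :: "'a::star_algebra \<Rightarrow> 'a \<otimes> 'a" and \<epsilon>A :: "'a \<Rightarrow> complex"
    and act :: "'a \<Rightarrow> 'b::star_algebra \<Rightarrow> 'b" and \<gamma> :: "'b \<Rightarrow> 'a \<otimes> 'b"
    and \<Delta>B :: "'b \<Rightarrow> 'b \<otimes> 'b" and \<epsilon>B :: "'b \<Rightarrow> complex"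
    and T :: real
    and \<Phi> :: "'e::star_algebra \<Rightarrow> complex" and j :: "real \<Rightarrow> real \<Rightarrow> 'b \<Rightarrow> 'e"
    and \<Phi>H :: "'h::star_algebra \<Rightarrow> complex" and jH :: "real \<Rightarrow> real \<Rightarrow> 'b \<otimes> 'a \<Rightarrow> 'h"
    and \<phi> :: "real \<Rightarrow> 'b \<Rightarrow> complex"
  assumes "braided_star_bialgebra \<Delta>A \<epsilon>A act \<gamma> \<Delta>B \<epsilon>B"
    and "0 \<le> T"
    and "levy_process (braided_structure act \<gamma> \<Delta>B \<epsilon>B) T \<Phi> j"
    and "has_convolution_semigroup T \<Phi> j \<phi>"
    and "levy_process (symmetrization \<Delta>A \<epsilon>A act \<gamma> \<Delta>B \<epsilon>B) T \<Phi>H jH"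
    and "has_convolution_semigroup T \<Phi>H jH (\<lambda>t. extend_functional \<epsilon>A (\<phi> t))"
  shows "levy_process (braided_structure act \<gamma> \<Delta>B \<epsilon>B) T \<Phi>H (hat_process \<gamma> jH)
    \<and> equivalent_processes T \<Phi>H (hat_process \<gamma> jH) \<Phi> j"
proof -
  let ?D = "braided_structure act \<gamma> \<Delta>B \<epsilon>B"
  interpret braided_algebra \<Delta>A \<epsilon>A act \<gamma> \<Delta>B \<epsilon>B
    by (rule braided_star_bialgebra_imp[OF assms(1)])
  interpret split_process \<Delta>A \<epsilon>A act \<gamma> \<Delta>B \<epsilon>B T "\<lambda>s t a. jH s t (1 \<otimes> a)" "\<lambda>s t b. jH s t (b \<otimes> 1)"
    by (rule levy_process_split[OF assms(5)])
  have hat: "hat = hat_process \<gamma> jH"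
    by (simp add: fun_eq_iff hat_def hat_process_def)
  have \<Phi>: "clinear \<Phi>" "state \<Phi>H" "clinear \<Phi>H"
    using assms(3,5) by (simp_all add: levy_process_def state_def)
  have marginal: "\<Phi> (j s t b) = \<phi> (t - s) b" and marginalH: "\<Phi>H (jH s t x) = extend_functional \<epsilon>A (\<phi> (t - s)) x"
    if "valid_interval T s t" for s t b x
    using assms(4,6) that
    by (simp_all add: has_convolution_semigroup_def valid_interval_def fun_eq_iff)
  have j: "braided_increments ?D T j" by (rule levy_process_braided_increments[OF assms(3)])
  \<comment> \<open>Linearity of \<open>\<phi>\<close> is inherited from the marginals, hence
    obtained at lengths of valid intervals.\<close>
  have \<phi>: "clinear (\<phi> (t - s))" if v: "valid_interval T s t" for s t
  proof -
    have "clinear (j s t)" using j v by (simp add: braided_increments_def)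
    from clinear_compose[OF \<Phi>(1) this] show ?thesis by (simp add: marginal[OF v])
  qed
  have pure: "jH s t (b \<otimes> 1) * jH s t (1 \<otimes> c) = jH s t (b \<otimes> c)" if "valid_interval T s t" for s t b c
    using assms(5) that by (intro hom_pure_tensor) (simp add: levy_process_def valid_interval_def)
  have "equivalent_processes T \<Phi>H hat \<Phi> j"
  proof (rule equivalent_if_grid_moments_eq[OF hat_braided_increments j assms(2) \<Phi>(3,1)])
    fix n \<tau> and b :: "nat \<Rightarrow> 'b" assume \<tau>: "grid T n \<tau>"
    have v: "valid_interval T (\<tau> i) (\<tau> (Suc i))" if "grid T m \<tau>" "i < m" for i m
      using grid_valid_interval[OF that(1), of i "Suc i"] that by simp
    have "\<Phi>H (prod_list (map (\<lambda>i. hat (\<tau> i) (\<tau> (Suc i)) (b i)) [0..<n])) = (\<Prod>i<n. \<phi> (\<tau> (Suc i) - \<tau> i) (b i))"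
    proof (rule hat_grid_moment[where \<phi> = \<phi>, OF \<Phi>(3) \<phi> \<tau>])
      fix m b c assume m: "grid T m \<tau>"
      \<comment> \<open>The two restrictions recombine to values of \<open>jH\<close> at pure
        tensors, to which independence and the marginals of \<open>jH\<close> apply.\<close>
      have "map (\<lambda>i. jH (\<tau> i) (\<tau> (Suc i)) (b i \<otimes> 1) * jH (\<tau> i) (\<tau> (Suc i)) (1 \<otimes> c i)) [0..<m]
        = map (\<lambda>i. jH (\<tau> i) (\<tau> (Suc i)) (b i \<otimes> c i)) [0..<m]"
        by (simp add: pure v[OF m])
      then have "\<Phi>H (prod_list (map (\<lambda>i. jH (\<tau> i) (\<tau> (Suc i)) (b i \<otimes> 1) * jH (\<tau> i) (\<tau> (Suc i)) (1 \<otimes> c i)) [0..<m]))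
        = (\<Prod>i<m. \<Phi>H (jH (\<tau> i) (\<tau> (Suc i)) (b i \<otimes> c i)))"
        by (simp only: levy_process_grid_moments[OF assms(5) m])
      also have "\<dots> = (\<Prod>i<m. \<phi> (\<tau> (Suc i) - \<tau> i) (b i) * \<epsilon>A (c i))"
      proof (rule prod.cong[OF refl])
        fix i assume "i \<in> {..<m}"
        then have vi: "valid_interval T (\<tau> i) (\<tau> (Suc i))" using v[OF m] by simp
        have "cbilinear (\<lambda>b a. \<phi> (\<tau> (Suc i) - \<tau> i) b * \<epsilon>A a)"
          by (intro lin_maps clinear_compose[OF \<phi>[OF vi]])
        then show "\<Phi>H (jH (\<tau> i) (\<tau> (Suc i)) (b i \<otimes> c i)) = \<phi> (\<tau> (Suc i) - \<tau> i) (b i) * \<epsilon>A (c i)"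
          by (simp add: marginalH[OF vi] extend_functional_def tlift_tensor)
      qed
      finally show "\<Phi>H (prod_list (map (\<lambda>i. jH (\<tau> i) (\<tau> (Suc i)) (b i \<otimes> 1) * jH (\<tau> i) (\<tau> (Suc i)) (1 \<otimes> c i)) [0..<m]))
        = (\<Prod>i<m. \<phi> (\<tau> (Suc i) - \<tau> i) (b i) * \<epsilon>A (c i))" .
    qed
    also have "\<dots> = \<Phi> (prod_list (map (\<lambda>i. j (\<tau> i) (\<tau> (Suc i)) (b i)) [0..<n]))"
      by (simp add: levy_process_grid_moments[OF assms(3) \<tau>] marginal v[OF \<tau>])
    finally show "\<Phi>H (prod_list (map (\<lambda>i. hat (\<tau> i) (\<tau> (Suc i)) (b i)) [0..<n]))
      = \<Phi> (prod_list (map (\<lambda>i. j (\<tau> i) (\<tau> (Suc i)) (b i)) [0..<n]))" .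
  qed
  moreover from this have "levy_process ?D T \<Phi>H hat"
    by (rule levy_process_of_equivalent[OF assms(3) _ \<Phi>(2) hat_braided_increments])
      (simp add: braided_structure_def hat_star)
  ultimately show ?thesis by (simp only: hat)
qed

end
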